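(* Let $k\subset L$ be a finite separable field extension with normal closure $N$. If $k\subset N$ is a cyclic extension with square-free degree, then $k\subset L$ is a Boolean extension. In particular, a finite Galois extension $k\subset L$ with Galois group $G$ is Boolean if and only if $k\subset L$ is a cyclic extension whose degree is square free.
   Context: For a finite field extension $k\subset L$, $[k,L]$ is the set of intermediate fields, a lattice under inclusion, with infimum the intersection and supremum the compositum. The extension is Boolean if the lattice $[k,L]$ is distributive and each $T\in[k,L]$ has a complement, i.e. some $T'\in[k,L]$ with $T\cap T'=k$ and $TT'=L$. A cyclic extension is a Galois extension with cyclic Galois group. *)

theory Defs
  imports
    "HOL-Algebra.Algebraic_Closure"
    "HOL-Algebra.Generated_Fields"
    "HOL-Algebra.Elementary_Groups"
    "HOL-Algebra.Bij"
    "HOL-Computational_Algebra.Squarefree"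
begin

text \<open>
  All fields of an extension are subfields of one ambient field \<open>E\<close>, which is arbitrary: it need
  not be algebraically closed, and it may coincide with the largest field under consideration.
\<close>

definition field_extension :: "('a, 'b) ring_scheme \<Rightarrow> 'a set \<Rightarrow> 'a set \<Rightarrow> bool"
  where "field_extension E k L \<longleftrightarrow> subfield k E \<and> subfield L E \<and> k \<subseteq> L"

definition finite_extension :: "('a, 'b) ring_scheme \<Rightarrow> 'a set \<Rightarrow> 'a set \<Rightarrow> bool"
  where "finite_extension E k L \<longleftrightarrow> field_extension E k L \<and> ring.finite_dimension E k L"

text \<open>The conjunct on finiteness is needed because \<^const>\<open>ring.dim\<close> is an unspecified natural
  number for extensions of infinite degree.\<close>

definition squarefree_degree :: "('a, 'b) ring_scheme \<Rightarrow> 'a set \<Rightarrow> 'a set \<Rightarrow> bool"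
  where "squarefree_degree E k L \<longleftrightarrow> ring.finite_dimension E k L \<and> squarefree (ring.dim E k L)"

definition intermediate_fields :: "('a, 'b) ring_scheme \<Rightarrow> 'a set \<Rightarrow> 'a set \<Rightarrow> 'a set set"
  where "intermediate_fields E k L = {T. subfield T E \<and> k \<subseteq> T \<and> T \<subseteq> L}"

definition compositum :: "('a, 'b) ring_scheme \<Rightarrow> 'a set \<Rightarrow> 'a set \<Rightarrow> 'a set"
  where "compositum E S T = generate_field E (S \<union> T)"

definition distributive_extension :: "('a, 'b) ring_scheme \<Rightarrow> 'a set \<Rightarrow> 'a set \<Rightarrow> bool"
  where "distributive_extension E k L \<longleftrightarrow>
    (\<forall>S \<in> intermediate_fields E k L. \<forall>T \<in> intermediate_fields E k L.
       \<forall>U \<in> intermediate_fields E k L.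
       S \<inter> compositum E T U = compositum E (S \<inter> T) (S \<inter> U))"

definition boolean_extension :: "('a, 'b) ring_scheme \<Rightarrow> 'a set \<Rightarrow> 'a set \<Rightarrow> bool"
  where "boolean_extension E k L \<longleftrightarrow>
    distributive_extension E k L \<and>
    (\<forall>T \<in> intermediate_fields E k L. \<exists>T' \<in> intermediate_fields E k L.
       T \<inter> T' = k \<and> compositum E T T' = L)"

text \<open>
  An element is separable over \<open>k\<close> if its minimal polynomial over \<open>k\<close> has no multiple root in an
  algebraically closed field containing \<open>k\<close>; the one used is the algebraic closure of \<open>E\<close>, into
  which \<open>E\<close> embeds by \<^const>\<open>ring.indexed_const\<close>.
\<close>

definition separable_element :: "('a, 'b) ring_scheme \<Rightarrow> 'a set \<Rightarrow> 'a \<Rightarrow> bool"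
  where "separable_element E k x \<longleftrightarrow>
    ring.algebraic E k x \<and>
    (\<forall>a \<in> carrier (field.alg_closure E).
       ring.alg_mult (field.alg_closure E) (map (ring.indexed_const E) (ring.Irr E k x)) a \<le> 1)"

definition separable_extension :: "('a, 'b) ring_scheme \<Rightarrow> 'a set \<Rightarrow> 'a set \<Rightarrow> bool"
  where "separable_extension E k L \<longleftrightarrow>
    field_extension E k L \<and> (\<forall>x \<in> L. separable_element E k x)"

text \<open>
  Splitting in \<open>L\<close> is expressed by \<^const>\<open>ring.splitted\<close> over the ring with carrier \<open>L\<close>.
  \<^const>\<open>ring.splitted_on\<close> would be wrong: it ignores multiplicities and has no roots at all on an
  infinite set.
\<close>

definition normal_extension :: "('a, 'b) ring_scheme \<Rightarrow> 'a set \<Rightarrow> 'a set \<Rightarrow> bool"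
  where "normal_extension E k L \<longleftrightarrow>
    field_extension E k L \<and> (\<forall>x \<in> L. ring.algebraic E k x) \<and>
    (\<forall>p \<in> carrier (univ_poly E k).
       pirreducible\<^bsub>E\<^esub> k p \<and> (\<exists>x \<in> L. ring.eval E p x = \<zero>\<^bsub>E\<^esub>) \<longrightarrow>
       ring.splitted (E\<lparr>carrier := L\<rparr>) p)"

definition normal_closure :: "('a, 'b) ring_scheme \<Rightarrow> 'a set \<Rightarrow> 'a set \<Rightarrow> 'a set \<Rightarrow> bool"
  where "normal_closure E k L N \<longleftrightarrow>
    field_extension E L N \<and> normal_extension E k N \<and>
    (\<forall>M. field_extension E L M \<and> M \<subseteq> N \<and> normal_extension E k M \<longrightarrow> M = N)"

definition galois_extension :: "('a, 'b) ring_scheme \<Rightarrow> 'a set \<Rightarrow> 'a set \<Rightarrow> bool"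
  where "galois_extension E k L \<longleftrightarrow> normal_extension E k L \<and> separable_extension E k L"

text \<open>As in \<^const>\<open>Bij\<close>, automorphisms are extensional functions, so that an automorphism of \<open>L\<close>
  is represented by exactly one function on the type of \<open>E\<close>.\<close>

definition galois_group :: "('a, 'b) ring_scheme \<Rightarrow> 'a set \<Rightarrow> 'a set \<Rightarrow> ('a \<Rightarrow> 'a) monoid"
  where "galois_group E k L = (BijGroup L)
    \<lparr>carrier := {s \<in> Bij L. s \<in> ring_hom (E\<lparr>carrier := L\<rparr>) (E\<lparr>carrier := L\<rparr>) \<and> (\<forall>x \<in> k. s x = x)}\<rparr>"

definition cyclic_extension :: "('a, 'b) ring_scheme \<Rightarrow> 'a set \<Rightarrow> 'a set \<Rightarrow> bool"
  where "cyclic_extension E k L \<longleftrightarrow>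
    galois_extension E k L \<and> cyclic_group (galois_group E k L)"

end

theory Submission
  imports Defs
begin

text \<open>
  By the primitive element theorem \<open>L = k(\<theta>)\<close>; for an intermediate field \<open>T\<close> the automorphisms fixing
  \<open>T\<close> correspond to the roots of the minimal polynomial of \<open>\<theta>\<close> over \<open>T\<close>, so their number is \<open>[L:T]\<close>.
  Comparing degrees yields the Galois correspondence, and \<open>[k,L]\<close> is Boolean iff the subgroup
  lattice of the Galois group \<open>G\<close> is.

  If the subgroup lattice of a finite group is distributive, then \<open>xy \<in> \<langle>xy\<rangle> \<inter> \<langle>x,y\<rangle>\<close> is a product of
  elements of \<open>\<langle>xy\<rangle> \<inter> \<langle>x\<rangle>\<close> and \<open>\<langle>xy\<rangle> \<inter> \<langle>y\<rangle>\<close>, all of which commute with \<open>x\<close>, so \<open>G\<close> is abelian. Take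
  \<open>\<langle>c\<rangle>\<close> of maximal order with complement \<open>H\<close>. For \<open>h \<in> H\<close> distributivity applied to
  \<open>ch \<in> \<langle>ch\<rangle> \<inter> \<langle>c,h\<rangle>\<close> gives \<open>c \<in> \<langle>ch\<rangle>\<close>, so \<open>h \<in> \<langle>c\<rangle> \<inter> H = 1\<close> by maximality, and \<open>G = \<langle>c\<rangle>\<close>. The
  subgroup lattice of a cyclic group of order \<open>n\<close> is dual to the divisor lattice of \<open>n\<close>, which is
  distributive, and complemented iff \<open>n\<close> is square-free.

  In the first part \<open>[k,L]\<close> is an interval of the Boolean lattice \<open>[k,N]\<close>.
\<close>

section \<open>Finite groups with Boolean subgroup lattice\<close>

text \<open>The law has joins over meets because the inclusion-reversing Galois correspondence turns
  the law of \<open>distributive_extension\<close> into this one.\<close>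

definition boolean_subgroup_lattice :: "('a, 'b) monoid_scheme \<Rightarrow> bool"
  where "boolean_subgroup_lattice G \<longleftrightarrow>
    (\<forall>A B C. subgroup A G \<and> subgroup B G \<and> subgroup C G \<longrightarrow>
       generate G (A \<union> (B \<inter> C)) = generate G (A \<union> B) \<inter> generate G (A \<union> C)) \<and>
    (\<forall>A. subgroup A G \<longrightarrow>
       (\<exists>B. subgroup B G \<and> A \<inter> B = {\<one>\<^bsub>G\<^esub>} \<and> generate G (A \<union> B) = carrier G))"

context group
begin

lemma generate_Un_absorb:
  assumes "subgroup A G" "B \<subseteq> A"
  shows "generate G (A \<union> B) = A"
  using assms by (metis Un_absorb2 generateI subset_refl)

text \<open>In any lattice one distributive law implies its dual: expand the join of the two meets
  by the given law, then absorb.\<close>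

lemma inter_generate_distrib:
  assumes lat: "boolean_subgroup_lattice G"
    and A: "subgroup A G" and B: "subgroup B G" and C: "subgroup C G"
  shows "A \<inter> generate G (B \<union> C) = generate G ((A \<inter> B) \<union> (A \<inter> C))"
proof -
  have dist: "generate G (P \<union> (Q \<inter> R)) = generate G (P \<union> Q) \<inter> generate G (P \<union> R)"
    if "subgroup P G" "subgroup Q G" "subgroup R G" for P Q R
    using lat that unfolding boolean_subgroup_lattice_def by blast
  have AB: "subgroup (A \<inter> B) G"
    using A B by (rule subgroups_Inter_pair)
  have "generate G ((A \<inter> B) \<union> (A \<inter> C)) =
        generate G (A \<union> (A \<inter> B)) \<inter> generate G (C \<union> (A \<inter> B))"
    using dist[OF AB A C] by (simp add: Un_commute)
  also have "generate G (A \<union> (A \<inter> B)) = A"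
    using generate_Un_absorb[OF A Int_lower1] .
  also have "generate G (C \<union> (A \<inter> B)) = generate G (A \<union> C) \<inter> generate G (B \<union> C)"
    using dist[OF C A B] by (simp add: Un_commute)
  also have "A \<inter> (generate G (A \<union> C) \<inter> generate G (B \<union> C)) = A \<inter> generate G (B \<union> C)"
    using generate.incl[of _ "A \<union> C" G] by blast
  finally show ?thesis by simp
qed

text \<open>Reduces commuting with \<open>x\<close> on a generated subgroup to commuting with
  \<open>x\<close> on its generators.\<close>

lemma subgroup_centralizer:
  assumes "x \<in> carrier G"
  shows "subgroup {g \<in> carrier G. g \<otimes> x = x \<otimes> g} G"
proof (rule subgroupI)
  fix a assume a: "a \<in> {g \<in> carrier G. g \<otimes> x = x \<otimes> g}"
  then have "inv a \<otimes> (a \<otimes> x) \<otimes> inv a = inv a \<otimes> (x \<otimes> a) \<otimes> inv a"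
    by simp
  moreover have "inv a \<otimes> (a \<otimes> x) \<otimes> inv a = x \<otimes> inv a"
    using a assms by (metis (no_types, lifting) inv_closed l_inv l_one m_assoc mem_Collect_eq)
  moreover have "inv a \<otimes> (x \<otimes> a) \<otimes> inv a = inv a \<otimes> x"
    using a assms by (simp add: m_assoc)
  ultimately have "inv a \<otimes> x = x \<otimes> inv a"
    by metis
  then show "inv a \<in> {g \<in> carrier G. g \<otimes> x = x \<otimes> g}"
    using a by blast
next
  fix a b
  assume a: "a \<in> {g \<in> carrier G. g \<otimes> x = x \<otimes> g}" and b: "b \<in> {g \<in> carrier G. g \<otimes> x = x \<otimes> g}"
  then have "a \<otimes> (b \<otimes> x) = a \<otimes> (x \<otimes> b)" "a \<otimes> x \<otimes> b = x \<otimes> a \<otimes> b"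
    by simp_all
  then have "a \<otimes> b \<otimes> x = x \<otimes> (a \<otimes> b)"
    using a b assms by (metis (no_types, lifting) m_assoc mem_Collect_eq)
  then show "a \<otimes> b \<in> {g \<in> carrier G. g \<otimes> x = x \<otimes> g}"
    using a b by simp
qed (use assms in auto)

lemma generate_singleton_commute:
  assumes "x \<in> carrier G" "y \<in> generate G {x}"
  shows "y \<otimes> x = x \<otimes> y"
  using generate_subgroup_incl[OF _ subgroup_centralizer[OF assms(1)], of "{x}"] assms by auto

lemma boolean_subgroup_lattice_imp_comm:
  assumes lat: "boolean_subgroup_lattice G"
    and x: "x \<in> carrier G" and y: "y \<in> carrier G"
  shows "x \<otimes> y = y \<otimes> x"
proof -
  define A P Q where "A = generate G {x \<otimes> y}" and "P = generate G {x}" and "Q = generate G {y}"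
  have sub: "subgroup A G" "subgroup P G" "subgroup Q G"
    using x y by (auto simp: A_def P_def Q_def intro!: generate_is_subgroup)
  have "x \<in> generate G (P \<union> Q)" "y \<in> generate G (P \<union> Q)"
    unfolding P_def Q_def by (auto intro!: generate.incl)
  then have "x \<otimes> y \<in> A \<inter> generate G (P \<union> Q)"
    by (auto simp: A_def intro: generate.incl generate.eng)
  then have xy: "x \<otimes> y \<in> generate G ((A \<inter> P) \<union> (A \<inter> Q))"
    using inter_generate_distrib[OF lat sub] by simp
  have "(A \<inter> P) \<union> (A \<inter> Q) \<subseteq> {g \<in> carrier G. g \<otimes> x = x \<otimes> g}"
  proof
    fix g assume "g \<in> (A \<inter> P) \<union> (A \<inter> Q)"
    then have g: "g \<in> A" "g \<in> carrier G" and "g \<in> P \<or> g \<in> Q"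
      using sub by (auto dest: subgroup.mem_carrier)
    show "g \<in> {g \<in> carrier G. g \<otimes> x = x \<otimes> g}"
    proof (cases "g \<in> P")
      case True
      then show ?thesis
        using generate_singleton_commute[OF x, of g] g unfolding P_def by simp
    next
      case False
      then have "g \<otimes> y = y \<otimes> g"
        using generate_singleton_commute[OF y, of g] \<open>g \<in> P \<or> g \<in> Q\<close> unfolding Q_def by simp
      \<comment> \<open>An element of \<open>A \<inter> Q\<close> commutes with \<open>xy\<close> as
        a power of it, and with \<open>y\<close>; cancelling \<open>y\<close> shows that it commutes
        with \<open>x\<close>.\<close>
      moreover have "g \<otimes> (x \<otimes> y) = x \<otimes> y \<otimes> g"
        using generate_singleton_commute[of "x \<otimes> y" g] g x y unfolding A_def by simp
      ultimately have "g \<otimes> x \<otimes> y = x \<otimes> g \<otimes> y"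
        using g x y by (simp add: m_assoc)
      then show ?thesis
        using g x y by simp
    qed
  qed
  \<comment> \<open>Hence \<open>xy\<close> itself commutes with \<open>x\<close>, and cancelling
    \<open>x\<close> on the left gives the claim.\<close>
  then have "x \<otimes> y \<in> {g \<in> carrier G. g \<otimes> x = x \<otimes> g}"
    using xy generate_subgroup_incl[OF _ subgroup_centralizer[OF x]] by blast
  then have "x \<otimes> (x \<otimes> y) = x \<otimes> (y \<otimes> x)"
    using x y by (simp add: m_assoc)
  then show ?thesis
    using x y by simp
qed

lemma boolean_subgroup_lattice_imp_cyclic:
  assumes fin: "finite (carrier G)" and lat: "boolean_subgroup_lattice G"
  shows "cyclic_group G"
proof -
  interpret comm_group G
    by (rule group_comm_groupI) (rule boolean_subgroup_lattice_imp_comm[OF lat])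
  have finsub: "finite A" if "subgroup A G" for A
    using fin subgroup.subset[OF that] by (rule finite_subset[rotated])
  have gen_sub: "subgroup (generate G {x}) G" if "x \<in> carrier G" for x
    using that by (intro generate_is_subgroup) auto
  \<comment> \<open>\<open>m\<close> is the largest order of a cyclic subgroup and \<open>c\<close>
    attains it. The complement \<open>H\<close> of the subgroup generated by \<open>c\<close> will
    turn out to be trivial.\<close>
  define m where "m = Max ((\<lambda>x. card (generate G {x})) ` carrier G)"
  have "m \<in> (\<lambda>x. card (generate G {x})) ` carrier G"
    unfolding m_def using fin by (intro Max_in) auto
  then obtain c where c: "c \<in> carrier G" and mc: "card (generate G {c}) = m"
    by auto
  have max: "card (generate G {x}) \<le> card (generate G {c})" if "x \<in> carrier G" for x
    unfolding mc unfolding m_def using fin that by simp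
  obtain H where H: "subgroup H G" "generate G {c} \<inter> H = {\<one>}"
    "generate G (generate G {c} \<union> H) = carrier G"
    using lat gen_sub[OF c] unfolding boolean_subgroup_lattice_def by blast
  have "h = \<one>" if h: "h \<in> H" for h
  proof -
    have hG: "h \<in> carrier G"
      using h H(1) by (rule subgroup.mem_carrier[rotated])
    define d where "d = c \<otimes> h"
    have dG: "d \<in> carrier G"
      using c hG by (simp add: d_def)
    let ?C = "generate G {c}" and ?D = "generate G {d}" and ?H = "generate G {h}"
    have "?H \<subseteq> H"
      using generate_subgroup_incl[OF _ H(1)] h by simp
    have "c \<in> generate G (?C \<union> ?H)" "h \<in> generate G (?C \<union> ?H)"
      by (auto intro!: generate.incl)
    then have "d \<in> ?D \<inter> generate G (?C \<union> ?H)"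
      by (auto simp: d_def intro: generate.incl generate.eng)
    also have "\<dots> = generate G ((?D \<inter> ?C) \<union> (?D \<inter> ?H))"
      using inter_generate_distrib[OF lat] gen_sub c hG dG by simp
    \<comment> \<open>In a commutative group the product set of two subgroups is a subgroup, so
      elements of the join are products.\<close>
    also have "\<dots> \<subseteq> (?D \<inter> ?C) <#> (?D \<inter> ?H)"
    proof (rule generate_subgroup_incl)
      have DC: "subgroup (?D \<inter> ?C) G" and DH: "subgroup (?D \<inter> ?H) G"
        using gen_sub c hG dG by (auto intro: subgroups_Inter_pair)
      then show "subgroup ((?D \<inter> ?C) <#> (?D \<inter> ?H)) G"
        by (rule mult_subgroups)
      show "(?D \<inter> ?C) \<union> (?D \<inter> ?H) \<subseteq> (?D \<inter> ?C) <#> (?D \<inter> ?H)"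
        using DC DH unfolding set_mult_def
        by (auto dest: subgroup.mem_carrier intro: bexI[of _ "\<one>"] simp: subgroup.one_closed)
           (metis IntI l_one r_one generate.one generate_in_carrier dG empty_subsetI insert_subset)+
    qed
    finally obtain p q where pq: "p \<in> ?D" "p \<in> ?C" "q \<in> ?D" "q \<in> ?H" "d = p \<otimes> q"
      unfolding set_mult_def by blast
    have pqG: "p \<in> carrier G" "q \<in> carrier G"
      using pq gen_sub dG by (auto dest: subgroup.mem_carrier)
    \<comment> \<open>Rearranging \<open>ch = pq\<close> puts one element into both
      \<open>?C\<close> and \<open>H\<close>, which meet trivially; hence
      \<open>p = c\<close>.\<close>
    have "inv c \<otimes> p = h \<otimes> inv q"
    proof -
      have "inv c \<otimes> (p \<otimes> q) \<otimes> inv q = inv c \<otimes> (c \<otimes> h) \<otimes> inv q"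
        using pq(5) by (simp add: d_def)
      then show ?thesis
        using c hG pqG by (metis inv_closed inv_solve_right l_inv m_assoc m_closed l_one r_one r_inv)
    qed
    moreover have "inv c \<otimes> p \<in> ?C"
      using gen_sub[OF c] pq(2) by (meson generate.incl singletonI subgroup_def)
    moreover have "h \<otimes> inv q \<in> H"
      using \<open>?H \<subseteq> H\<close> pq(4) h H(1) by (meson subgroup_def subsetD)
    ultimately have "inv c \<otimes> p = \<one>"
      using H(2) by auto
    then have "p = c"
      using c pqG by (metis inv_closed inv_inv inv_equality inv_unique' l_inv)
    then have "?C \<subseteq> ?D"
      using generate_subgroup_incl[OF _ gen_sub[OF dG]] pq(1) by simp
    \<comment> \<open>By maximality \<open>?C\<close> is not properly contained in the cyclic group
      \<open>?D\<close>; so \<open>d\<close>, and with it \<open>h\<close>, lies in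
      \<open>?C\<close>.\<close>
    then have "?C = ?D"
      using card_seteq[OF finsub[OF gen_sub[OF dG]] \<open>?C \<subseteq> ?D\<close>] max[OF dG] by simp
    then have "d \<in> ?C"
      using generate.incl[of d "{d}" G] by simp
    moreover have "h = inv c \<otimes> d"
      using c hG by (simp add: d_def m_assoc[symmetric])
    ultimately have "h \<in> ?C"
      using gen_sub[OF c] generate.incl[of c "{c}" G] by (simp add: subgroup_def)
    then show "h = \<one>"
      using H(2) h by auto
  qed
  then have "H \<subseteq> generate G {c}"
    using generate.one by fastforce
  then have "carrier G = generate G {c}"
    using generate_Un_absorb[OF gen_sub[OF c]] H(3) by simp
  then show ?thesis
    unfolding cyclic_group using c generate_pow[OF c] by auto
qed

end

section \<open>Subgroups of a finite cyclic group and divisors of its order\<close>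

locale finite_cyclic_group = group +
  fixes g
  assumes finite: "finite (carrier G)" and g: "g \<in> carrier G"
    and powers: "carrier G = range (\<lambda>i::int. g [^] i)"
begin

text \<open>For \<open>d\<close> dividing the order this is the subgroup of index \<open>d\<close>.
  Parametrizing by the index makes intersections correspond to \<open>lcm\<close> and joins to
  \<open>gcd\<close>.\<close>

definition pw :: "nat \<Rightarrow> 'a set"
  where "pw d = {g [^] i | i::int. int d dvd i}"

lemma int_pow_eq_iff: "g [^] (i::int) = g [^] (j::int) \<longleftrightarrow> int (order G) dvd j - i"
proof -
  have "carrier (subgroup_generated G {g}) = carrier G"
    using powers carrier_subgroup_generated_by_singleton[OF g] by simp
  then have "ord g = order G"
    using cyclic_order_is_ord[OF g] powers generate_pow[OF g] unfolding order_def
    by (simp add: full_SetCompr_eq)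
  then show ?thesis
    using int_pow_eq[OF g] by simp
qed

lemma order_pos: "0 < order G"
  using order_gt_0_iff_finite finite by blast

text \<open>An exponent is determined only modulo \<open>order G\<close>; since \<open>d\<close>
  divides the order, divisibility by \<open>d\<close> does not depend on the exponent
  chosen.\<close>

lemma pw_mem_iff:
  assumes "d dvd order G"
  shows "g [^] (i::int) \<in> pw d \<longleftrightarrow> int d dvd i"
proof
  assume "g [^] i \<in> pw d"
  then obtain j where "int (order G) dvd j - i" "int d dvd j"
    unfolding pw_def using int_pow_eq_iff by blast
  then have "int d dvd j - (j - i)"
    using assms by (meson dvd_diff dvd_trans int_dvd_int_iff)
  then show "int d dvd i"
    by simp
qed (auto simp: pw_def)

lemma subgroup_pw: "subgroup (pw d) G"
proof (rule subgroupI)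
  show "pw d \<subseteq> carrier G" "pw d \<noteq> {}"
    using g by (auto simp: pw_def)
next
  fix a assume "a \<in> pw d"
  then show "inv a \<in> pw d"
    using g unfolding pw_def by (auto simp flip: int_pow_neg)
next
  fix a b assume "a \<in> pw d" "b \<in> pw d"
  then show "a \<otimes> b \<in> pw d"
    using g unfolding pw_def by (auto simp flip: int_pow_mult intro: dvd_add)
qed

lemma pw_1 [simp]: "pw (Suc 0) = carrier G"
  unfolding pw_def powers by auto

lemma pw_order [simp]: "pw (order G) = {\<one>}"
proof -
  have iff: "g [^] i = \<one> \<longleftrightarrow> int (order G) dvd i" for i :: int
    using int_pow_eq_iff[of 0 i] by auto
  show ?thesis
  proof
    show "pw (order G) \<subseteq> {\<one>}"
      unfolding pw_def using iff by blast
    show "{\<one>} \<subseteq> pw (order G)"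
      using subgroup.one_closed[OF subgroup_pw] by simp
  qed
qed

text \<open>Division with remainder: the least positive exponent occurring in \<open>H\<close>
  divides all exponents occurring in \<open>H\<close>, among them \<open>order G\<close>.\<close>

lemma subgroup_pw_cases:
  assumes H: "subgroup H G"
  obtains d where "d dvd order G" "H = pw d"
proof -
  define S where "S = {i::nat. 0 < i \<and> g [^] i \<in> H}"
  define d where "d = (LEAST i. i \<in> S)"
  have "g [^] int (order G) = \<one>"
    using int_pow_eq_iff[of "int (order G)" 0] by simp
  then have "order G \<in> S"
    using order_pos subgroup.one_closed[OF H] unfolding S_def by (simp add: int_pow_int)
  then have "d \<in> S"
    unfolding d_def by (rule LeastI)
  then have d: "0 < d" "g [^] int d \<in> H"
    unfolding S_def by (auto simp: int_pow_int)
  have key: "g [^] i \<in> H \<longleftrightarrow> int d dvd i" for i :: int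
  proof
    assume i: "g [^] i \<in> H"
    have "g [^] (int d * (i div int d)) \<in> H"
      using subgroup_int_pow_closed[OF H d(2)] int_pow_pow[OF g] by simp
    then have "g [^] (i - int d * (i div int d)) \<in> H"
      using i H g by (simp add: int_pow_diff subgroup.m_closed subgroup.m_inv_closed)
    then have "g [^] (i mod int d) \<in> H"
      by (simp add: minus_mult_div_eq_mod)
    then have "g [^] nat (i mod int d) \<in> H"
      using d(1) by (metis int_pow_int nat_0_le of_nat_0_less_iff pos_mod_sign)
    \<comment> \<open>The remainder is smaller than the least element of \<open>S\<close>, so it can
      only be zero.\<close>
    moreover have "nat (i mod int d) \<notin> S"
      unfolding d_def by (rule not_less_Least) (use d(1) in \<open>simp add: nat_less_iff flip: d_def\<close>)
    ultimately have "nat (i mod int d) = 0"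
      unfolding S_def by simp
    then have "i mod int d = 0"
      using d(1) pos_mod_sign[of "int d" i] by linarith
    then show "int d dvd i"
      by presburger
  next
    assume "int d dvd i"
    then obtain j where "i = int d * j"
      by (elim dvdE)
    then show "g [^] i \<in> H"
      using subgroup_int_pow_closed[OF H d(2), of j] int_pow_pow[OF g] by simp
  qed
  have "d dvd order G"
    using key[of "int (order G)"] \<open>g [^] int (order G) = \<one>\<close> subgroup.one_closed[OF H] by simp
  moreover have "H = pw d"
  proof (intro equalityI subsetI)
    fix x assume "x \<in> H"
    moreover from this obtain i :: int where "x = g [^] i"
      using subgroup.mem_carrier[OF H] powers by blast
    ultimately show "x \<in> pw d"
      using key unfolding pw_def by blast
  next
    fix x assume "x \<in> pw d"
    then show "x \<in> H"
      using key unfolding pw_def by blast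
  qed
  ultimately show thesis ..
qed

lemma pw_inter:
  assumes "a dvd order G" "b dvd order G"
  shows "pw a \<inter> pw b = pw (lcm a b)"
proof -
  have "x \<in> pw a \<inter> pw b \<longleftrightarrow> x \<in> pw (lcm a b)" if "x \<in> carrier G" for x
  proof -
    obtain i :: int where "x = g [^] i"
      using \<open>x \<in> carrier G\<close> powers by auto
    moreover have "int (lcm a b) dvd i \<longleftrightarrow> int a dvd i \<and> int b dvd i"
      by (metis lcm_int_int_eq lcm_least_iff)
    ultimately show ?thesis
      using pw_mem_iff assms by (simp add: lcm_least)
  qed
  then show ?thesis
    using subgroup.mem_carrier[OF subgroup_pw] by blast
qed

text \<open>Bezout's identity writes a multiple of \<open>gcd a b\<close> as a multiple of
  \<open>a\<close> plus a multiple of \<open>b\<close>.\<close>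

lemma generate_pw_Un: "generate G (pw a \<union> pw b) = pw (gcd a b)"
proof
  have "pw a \<union> pw b \<subseteq> pw (gcd a b)"
    unfolding pw_def by (fastforce intro: dvd_trans[of "int (gcd a b)"])
  then show "generate G (pw a \<union> pw b) \<subseteq> pw (gcd a b)"
    using subgroup_pw by (rule generate_subgroup_incl)
next
  show "pw (gcd a b) \<subseteq> generate G (pw a \<union> pw b)"
  proof
    fix x assume "x \<in> pw (gcd a b)"
    then obtain j :: int where x: "x = g [^] (int (gcd a b) * j)"
      unfolding pw_def dvd_def by blast
    obtain u v where uv: "u * int a + v * int b = gcd (int a) (int b)"
      using bezout_int by blast
    have "x = g [^] (int a * (u * j)) \<otimes> g [^] (int b * (v * j))"
      unfolding x int_pow_mult[OF g, symmetric] gcd_int_int_eq[symmetric] uv[symmetric]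
      by (simp add: algebra_simps)
    moreover have "g [^] (int a * (u * j)) \<in> pw a" "g [^] (int b * (v * j)) \<in> pw b"
      unfolding pw_def by auto
    ultimately show "x \<in> generate G (pw a \<union> pw b)"
      by (auto intro: generate.incl generate.eng)
  qed
qed

text \<open>Through \<open>pw\<close>, a complement of a divisor \<open>a\<close> of
  \<open>n\<close> is a divisor \<open>b\<close> with \<open>gcd a b = 1\<close> and
  \<open>lcm a b = n\<close>, that is, a coprime cofactor. The distributive law is that of
  \<open>gcd\<close> over \<open>lcm\<close>.\<close>

lemma boolean_iff_squarefree: "boolean_subgroup_lattice G \<longleftrightarrow> squarefree (order G)"
proof
  assume sf: "squarefree (order G)"
  show "boolean_subgroup_lattice G"
    unfolding boolean_subgroup_lattice_def
  proof (intro conjI allI impI)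
    fix A B C assume sub: "subgroup A G \<and> subgroup B G \<and> subgroup C G"
    obtain a b c where "a dvd order G" "A = pw a" "b dvd order G" "B = pw b" "c dvd order G" "C = pw c"
      using sub subgroup_pw_cases by metis
    then show "generate G (A \<union> (B \<inter> C)) = generate G (A \<union> B) \<inter> generate G (A \<union> C)"
      by (simp add: generate_pw_Un pw_inter gcd_lcm_distrib dvd_trans[OF gcd_dvd1])
  next
    fix A assume "subgroup A G"
    then obtain a where a: "a dvd order G" "A = pw a"
      by (rule subgroup_pw_cases)
    \<comment> \<open>The cofactor \<open>e\<close> yields the complement: the square of
      \<open>gcd a e\<close> divides \<open>a * e\<close>, so this gcd is 1.\<close>
    then obtain e where e: "order G = a * e"
      by (elim dvdE)
    then have "(gcd a e)\<^sup>2 dvd order G"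
      by (simp add: power2_eq_square mult_dvd_mono)
    then have "is_unit (gcd a e)"
      using sf unfolding squarefree_def by blast
    then have "gcd a e = 1"
      by simp
    moreover have "lcm a e = order G"
      using \<open>gcd a e = 1\<close> prod_gcd_lcm_nat[of a e] e by simp
    moreover have "e dvd order G"
      using e by simp
    ultimately have "A \<inter> pw e = {\<one>}" "generate G (A \<union> pw e) = carrier G"
      using a by (simp_all add: pw_inter generate_pw_Un)
    then show "\<exists>B. subgroup B G \<and> A \<inter> B = {\<one>} \<and> generate G (A \<union> B) = carrier G"
      using subgroup_pw by blast
  qed
next
  assume lat: "boolean_subgroup_lattice G"
  show "squarefree (order G)"
  proof (rule squarefreeI)
    fix m assume m: "m\<^sup>2 dvd order G"
    then have m1: "m dvd order G"
      by (metis dvd_trans dvd_triv_left power2_eq_square)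
    obtain B where B: "subgroup B G" "pw m \<inter> B = {\<one>}" "generate G (pw m \<union> B) = carrier G"
      using lat subgroup_pw unfolding boolean_subgroup_lattice_def by blast
    obtain b where b: "b dvd order G" "B = pw b"
      using B(1) by (rule subgroup_pw_cases)
    have "pw (gcd m b) = pw 1" "pw (lcm m b) = pw (order G)"
      using B b m1 by (simp_all add: generate_pw_Un pw_inter)
    \<comment> \<open>A divisor of the order is recovered from its subgroup, so equal subgroups give
      equal divisors.\<close>
    moreover have "pw d = pw e \<Longrightarrow> d dvd order G \<Longrightarrow> e dvd order G \<Longrightarrow> d = e" for d e
      using pw_mem_iff[of d] pw_mem_iff[of e] by (metis dvd_antisym dvd_refl int_dvd_int_iff)
    ultimately have "gcd m b = 1" "lcm m b = order G"
      using m1 b(1) by (auto simp: dvd_trans[OF gcd_dvd1] lcm_least)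
    then have "order G = m * b" "coprime m b"
      by (metis mult_1 prod_gcd_lcm_nat) (simp add: \<open>gcd m b = 1\<close> coprime_iff_gcd_eq_1)
    moreover have "0 < m"
      using m1 order_pos by (metis dvd_0_left_iff gr0I less_irrefl)
    \<comment> \<open>Cancel \<open>m\<close> in \<open>m * m dvd m * b\<close>. As \<open>m\<close>
      and \<open>b\<close> are coprime, \<open>m\<close> must then be a unit.\<close>
    ultimately have "m dvd b"
      using m by (simp add: power2_eq_square)
    then show "is_unit m"
      using \<open>coprime m b\<close> by (meson coprime_absorb_left coprime_def dvd_refl)
  qed
qed

end

lemma (in group) boolean_subgroup_lattice_iff:
  assumes "finite (carrier G)"
  shows "boolean_subgroup_lattice G \<longleftrightarrow> cyclic_group G \<and> squarefree (order G)"
proof -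
  have "boolean_subgroup_lattice G \<longleftrightarrow> squarefree (order G)" if cyc: "cyclic_group G"
  proof -
    obtain x where "finite_cyclic_group G x"
      using cyc assms group_axioms
      unfolding cyclic_group finite_cyclic_group_def finite_cyclic_group_axioms_def by blast
    then show ?thesis
      by (rule finite_cyclic_group.boolean_iff_squarefree)
  qed
  then show ?thesis
    using boolean_subgroup_lattice_imp_cyclic[OF assms] by blast
qed

section \<open>Polynomials and homomorphisms of fields\<close>

text \<open>A field homomorphism is injective, so it keeps leading coefficients nonzero and the
  normalization built into multiplication of coefficient lists changes nothing.\<close>

lemma poly_mult_field_hom:
  assumes h: "h \<in> ring_hom R S" and R: "field R" and S: "field S"
    and p: "p \<in> carrier (poly_ring R)" and q: "q \<in> carrier (poly_ring R)"
  shows "map h (p \<otimes>\<^bsub>poly_ring R\<^esub> q) = map h p \<otimes>\<^bsub>poly_ring S\<^esub> map h q"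
proof -
  interpret R: field R by (rule R)
  interpret S: field S by (rule S)
  interpret h: ring_hom_ring R S h
    by (rule ring_hom_ringI2[OF R.ring_axioms S.ring_axioms h])
  interpret UP: domain "poly_ring R"
    using R.univ_poly_is_domain[OF R.carrier_is_subring] .
  have "p \<otimes>\<^bsub>poly_ring R\<^esub> q \<in> carrier (poly_ring R)"
    using p q by simp
  then have "map h (p \<otimes>\<^bsub>poly_ring R\<^esub> q) \<in> carrier (poly_ring S)"
    by (rule polynomial_hom[OF h R S])
  then have "map h (p \<otimes>\<^bsub>poly_ring R\<^esub> q) = S.normalize (map h (p \<otimes>\<^bsub>poly_ring R\<^esub> q))"
    using S.normalize_polynomial by (simp add: univ_poly_carrier)
  also have "\<dots> = S.poly_mult (map h p) (map h q)"
    unfolding univ_poly_mult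
    using p q by (intro h.poly_mult_hom') (auto simp flip: univ_poly_carrier dest: R.polynomial_incl)
  finally show ?thesis
    by (simp add: univ_poly_mult)
qed

text \<open>A power of \<open>X - a\<close> dividing \<open>p\<close> is mapped to the same power of
  \<open>X - h(a)\<close> dividing the image. This brings separability, which is defined in an
  algebraic closure, down to \<open>L\<close>.\<close>

lemma (in field) alg_mult_hom_le:
  assumes h: "h \<in> ring_hom R S" and S: "field S"
    and p: "p \<in> carrier (poly_ring R)" "p \<noteq> []" and a: "a \<in> carrier R"
  shows "alg_mult p a \<le> ring.alg_mult S (map h p) (h a)"
proof -
  interpret S: field S by (rule S)
  interpret h: ring_hom_ring R S h
    by (rule ring_hom_ringI2[OF ring_axioms S.ring_axioms h])
  interpret UP: domain "poly_ring R"
    using univ_poly_is_domain[OF carrier_is_subring] .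
  interpret US: domain "poly_ring S"
    using S.univ_poly_is_domain[OF S.carrier_is_subring] .
  note mult = poly_mult_field_hom[OF h field_axioms S]
  have lin: "[\<one>, \<ominus> a] \<in> carrier (poly_ring R)"
    using a unfolding sym[OF univ_poly_carrier] polynomial_def by auto
  have pow: "map h ([\<one>, \<ominus> a] [^]\<^bsub>poly_ring R\<^esub> n) = [\<one>\<^bsub>S\<^esub>, \<ominus>\<^bsub>S\<^esub> h a] [^]\<^bsub>poly_ring S\<^esub> n" for n :: nat
  proof (induction n)
    case 0
    then show ?case
      by (simp add: univ_poly_one)
  next
    case (Suc n)
    then show ?case
      using mult[OF UP.nat_pow_closed[OF lin] lin, of n] a by simp
  qed
  obtain q where q: "q \<in> carrier (poly_ring R)"
      "p = [\<one>, \<ominus> a] [^]\<^bsub>poly_ring R\<^esub> alg_mult p a \<otimes>\<^bsub>poly_ring R\<^esub> q"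
    using alg_multE(1)[OF a p] unfolding pdivides_def by auto
  have "map h p = [\<one>\<^bsub>S\<^esub>, \<ominus>\<^bsub>S\<^esub> h a] [^]\<^bsub>poly_ring S\<^esub> alg_mult p a \<otimes>\<^bsub>poly_ring S\<^esub> map h q"
    using arg_cong[OF q(2), of "map h"] mult[OF UP.nat_pow_closed[OF lin] q(1)] pow by simp
  moreover have "map h q \<in> carrier (poly_ring S)"
    using polynomial_hom[OF h field_axioms S q(1)] .
  ultimately have "([\<one>\<^bsub>S\<^esub>, \<ominus>\<^bsub>S\<^esub> h a] [^]\<^bsub>poly_ring S\<^esub> alg_mult p a) pdivides\<^bsub>S\<^esub> map h p"
    unfolding pdivides_def factor_def by blast
  moreover have "map h p \<in> carrier (poly_ring S)"
    using polynomial_hom[OF h field_axioms S p(1)] .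
  ultimately show ?thesis
    using S.alg_multE(2)[of "h a" "map h p"] p(2) a by simp
qed

lemma (in field) subfieldI_closed:
  assumes "F \<subseteq> carrier R" "\<one> \<in> F"
    and "\<And>x. x \<in> F \<Longrightarrow> \<ominus> x \<in> F"
    and "\<And>x. x \<in> F \<Longrightarrow> x \<noteq> \<zero> \<Longrightarrow> inv x \<in> F"
    and "\<And>x y. x \<in> F \<Longrightarrow> y \<in> F \<Longrightarrow> x \<oplus> y \<in> F"
    and "\<And>x y. x \<in> F \<Longrightarrow> y \<in> F \<Longrightarrow> x \<otimes> y \<in> F"
  shows "subfield F R"
  using assms by (intro subfieldI' subringI) auto

lemma (in domain) subfield_closed:
  assumes "subfield F R"
  shows "F \<subseteq> carrier R" "\<zero> \<in> F" "\<one> \<in> F"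
    and "\<And>x. x \<in> F \<Longrightarrow> \<ominus> x \<in> F"
    and "\<And>x. x \<in> F \<Longrightarrow> x \<noteq> \<zero> \<Longrightarrow> inv x \<in> F"
    and "\<And>x y. x \<in> F \<Longrightarrow> y \<in> F \<Longrightarrow> x \<oplus> y \<in> F"
    and "\<And>x y. x \<in> F \<Longrightarrow> y \<in> F \<Longrightarrow> x \<otimes> y \<in> F"
  using subringE[OF subfieldE(1)[OF assms]] subfield_m_inv[OF assms] by auto

text \<open>The map sends \<open>p(x)\<close> to \<open>p(y)\<close>. It is well defined because
  polynomials that agree at \<open>x\<close> differ by a multiple of \<open>Irr K x\<close>, which
  vanishes at \<open>y\<close>.\<close>

lemma (in field) exists_conjugation:
  assumes K: "subfield K R" and x: "x \<in> carrier R" "(algebraic over K) x"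
    and y: "y \<in> carrier R" "eval (Irr K x) y = \<zero>"
  obtains \<phi> where "\<phi> \<in> ring_hom (R\<lparr>carrier := simple_extension K x\<rparr>) R"
    and "\<And>p. p \<in> carrier (K[X]) \<Longrightarrow> \<phi> (eval p x) = eval p y"
    and "\<And>c. c \<in> K \<Longrightarrow> \<phi> c = c" and "\<phi> x = y"
proof -
  note Kr = subfieldE(1)[OF K]
  interpret UK: domain "K[X]"
    using univ_poly_is_domain[OF Kr] .
  \<comment> \<open>An arbitrary polynomial representing \<open>a\<close> is picked;
    \<open>wd\<close> shows that the choice does not affect the value.\<close>
  define \<phi> where "\<phi> a = eval (SOME p. p \<in> carrier (K[X]) \<and> eval p x = a) y" for a
  note evx = ring_hom_memE[OF eval_is_hom[OF Kr x(1)]]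
  note evy = ring_hom_memE[OF eval_is_hom[OF Kr y(1)]]
  interpret hx: ring_hom_ring "K[X]" R "\<lambda>p. eval p x"
    by (rule eval_ring_hom[OF Kr x(1)])
  interpret hy: ring_hom_ring "K[X]" R "\<lambda>p. eval p y"
    by (rule eval_ring_hom[OF Kr y(1)])
  have wd: "eval p y = eval q y" if p: "p \<in> carrier (K[X])" and q: "q \<in> carrier (K[X])"
    and eq: "eval p x = eval q x" for p q
  proof -
    have pq: "p \<ominus>\<^bsub>K[X]\<^esub> q \<in> carrier (K[X])"
      using p q by simp
    have "eval (p \<ominus>\<^bsub>K[X]\<^esub> q) x = \<zero>"
      using p q eq hx.hom_closed[OF q] unfolding a_minus_def by (simp add: r_neg)
    then have "Irr K x pdivides (p \<ominus>\<^bsub>K[X]\<^esub> q)"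
      using Irr_minimal[OF K x pq] by simp
    then have "eval (p \<ominus>\<^bsub>K[X]\<^esub> q) y = \<zero>"
      using pdivides_imp_root_sharing[OF _ _ y] IrrE(1)[OF K x] carrier_polynomial_shell[OF Kr]
      by blast
    then have "eval p y \<ominus> eval q y = \<zero>"
      using p q unfolding a_minus_def by simp
    then show ?thesis
      using hy.hom_closed p q by simp
  qed
  have \<phi>_eval: "\<phi> (eval p x) = eval p y" if "p \<in> carrier (K[X])" for p
    unfolding \<phi>_def
  proof (rule someI2)
    show "p \<in> carrier (K[X]) \<and> eval p x = eval p x"
      using that by simp
    show "eval q y = eval p y" if "q \<in> carrier (K[X]) \<and> eval q x = eval p x" for q
      using that \<open>p \<in> carrier (K[X])\<close> by (intro wd) simp_all
  qed
  have img: "\<exists>p. p \<in> carrier (K[X]) \<and> a = eval p x" if "a \<in> simple_extension K x" for a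
    using that simple_extension_as_eval_img[OF subringE(1)[OF Kr] x(1)] by auto
  have const: "\<phi> c = c" if "c \<in> K" for c
  proof -
    have c: "poly_of_const c \<in> carrier (K[X])" "c \<in> carrier R"
      using that subringE(1)[OF Kr] unfolding poly_of_const_def sym[OF univ_poly_carrier] polynomial_def
      by auto
    then have "eval (poly_of_const c) z = c" if "z \<in> carrier R" for z
      using that unfolding poly_of_const_def by auto
    then show ?thesis
      using \<phi>_eval[OF c(1)] x y by simp
  qed
  show thesis
  proof (rule that)
    show "\<phi> \<in> ring_hom (R\<lparr>carrier := simple_extension K x\<rparr>) R"
    proof (rule ring_hom_memI)
      fix a b assume "a \<in> carrier (R\<lparr>carrier := simple_extension K x\<rparr>)"
        and "b \<in> carrier (R\<lparr>carrier := simple_extension K x\<rparr>)"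
      then obtain p q where pq: "p \<in> carrier (K[X])" "a = eval p x" "q \<in> carrier (K[X])" "b = eval q x"
        using img[of a] img[of b] by auto
      show "\<phi> (a \<otimes>\<^bsub>R\<lparr>carrier := simple_extension K x\<rparr>\<^esub> b) = \<phi> a \<otimes> \<phi> b"
        using pq \<phi>_eval[of "p \<otimes>\<^bsub>K[X]\<^esub> q"] \<phi>_eval by simp
      show "\<phi> (a \<oplus>\<^bsub>R\<lparr>carrier := simple_extension K x\<rparr>\<^esub> b) = \<phi> a \<oplus> \<phi> b"
        using pq \<phi>_eval[of "p \<oplus>\<^bsub>K[X]\<^esub> q"] \<phi>_eval by simp
    next
      fix a assume "a \<in> carrier (R\<lparr>carrier := simple_extension K x\<rparr>)"
      then obtain p where "p \<in> carrier (K[X])" "a = eval p x"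
        using img by auto
      then show "\<phi> a \<in> carrier R"
        using \<phi>_eval hy.hom_closed by simp
    qed (simp add: const subringE(3)[OF Kr])
    show "\<phi> x = y"
      using \<phi>_eval[OF var_closed(1)[OF Kr]] eval_var x y by simp
  qed (use \<phi>_eval const in auto)
qed

text \<open>The coefficients do not move, so a homomorphism fixing \<open>K\<close> carries roots of
  polynomials over \<open>K\<close> to roots.\<close>

lemma (in ring) hom_eval_fixed:
  assumes "subring F R" "\<phi> \<in> ring_hom (R\<lparr>carrier := F\<rparr>) R"
    and "K \<subseteq> F" "\<And>c. c \<in> K \<Longrightarrow> \<phi> c = c" "p \<in> carrier (K[X])" "a \<in> F"
  shows "\<phi> (eval p a) = eval p (\<phi> a)"
proof -
  interpret h: ring_hom_ring "R\<lparr>carrier := F\<rparr>" R \<phi>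
    by (rule ring_hom_ringI2[OF subring_is_ring[OF assms(1)] ring_axioms assms(2)])
  have "set p \<subseteq> K"
    using assms(5) polynomial_incl unfolding sym[OF univ_poly_carrier] by blast
  then have "map \<phi> p = p" "set p \<subseteq> F"
    using assms(3,4) by (auto intro: map_idI)
  then show ?thesis
    using h.eval_hom'[of a p] assms(6) by (simp add: eval_consistent[OF assms(1)])
qed

text \<open>A basis of \<open>U\<close> is an independent list in \<open>V\<close>, which bounds its
  length; if the length is the dimension of \<open>V\<close>, it spans \<open>V\<close>.\<close>

lemma (in ring) dimension_mono:
  assumes K: "subfield K R" and U: "dimension n K U" and V: "dimension m K V" and "U \<subseteq> V"
  shows "n \<le> m" and "n = m \<Longrightarrow> U = V"
proof -
  obtain Us where Us: "set Us \<subseteq> carrier R" "independent K Us" "length Us = n" "Span K Us = U"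
    using exists_base[OF K U] by blast
  have "set Us \<subseteq> V"
    using Span_base_incl[OF K Us(1)] Us(4) \<open>U \<subseteq> V\<close> by simp
  then show "n \<le> m" "n = m \<Longrightarrow> U = V"
    using independent_length_le_dimension[OF K V Us(2)]
      independent_length_eq_dimension[OF K V Us(2)] Us(3,4) by auto
qed

text \<open>Shows that a finite extension of a finite field is finite, for the finite case of the
  primitive element theorem.\<close>

lemma (in ring) finite_Span:
  assumes K: "subfield K R" and "finite K" and "set Us \<subseteq> carrier R"
  shows "finite (Span K Us)"
  using assms(3)
proof (induction Us)
  case (Cons u Us)
  have "Span K (u # Us) \<subseteq> (\<lambda>(c, v). c \<otimes> u \<oplus> v) ` (K \<times> Span K Us)"
    using line_extension_mem_iff by auto
  moreover have "finite (K \<times> Span K Us)"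
    using Cons \<open>finite K\<close> by simp
  ultimately show ?case
    by (meson finite_imageI finite_subset)
qed simp

section \<open>Primitive elements\<close>

text \<open>Facts on \<open>L\<close> over an intermediate field \<open>T\<close> are stated
  relative to this one pair \<open>k\<close>, \<open>L\<close>, with \<open>T\<close> as a
  parameter, so that all Galois groups live inside a single group.\<close>

locale finite_galois = field +
  fixes k L
  assumes finite_dim: "finite_dimension k L" and galois: "galois_extension R k L"
begin

abbreviation inter :: "'a set set"
  where "inter \<equiv> intermediate_fields R k L"

lemma k_subfield: "subfield k R" and L_subfield: "subfield L R" and k_subset: "k \<subseteq> L"
  using galois unfolding galois_extension_def normal_extension_def field_extension_def by auto

lemma interD:
  assumes "T \<in> inter"
  shows "subfield T R" "k \<subseteq> T" "T \<subseteq> L" "T \<subseteq> carrier R"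
  using assms subfieldE(3) unfolding intermediate_fields_def by auto

lemma k_inter: "k \<in> inter" and L_inter: "L \<in> inter"
  using k_subfield L_subfield k_subset unfolding intermediate_fields_def by auto

lemma L_carrier: "x \<in> L \<Longrightarrow> x \<in> carrier R"
  using subfieldE(3)[OF L_subfield] by auto

lemma algebraic_inter: "T \<in> inter \<Longrightarrow> x \<in> L \<Longrightarrow> (algebraic over T) x"
  using finite_dimension_imp_algebraic[OF k_subfield subfieldE(1)[OF L_subfield] finite_dim]
    algebraic_mono interD by blast

text \<open>\<open>Irr T x\<close> divides \<open>Irr k x\<close>, which splits in \<open>L\<close>
  by normality and has only simple roots by separability. So \<open>Irr T x\<close> also splits into
  distinct linear factors over \<open>L\<close>.\<close>

lemma card_roots_Irr:
  assumes T: "T \<in> inter" and x: "x \<in> L"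
  shows "card {y \<in> L. eval (Irr T x) y = \<zero>} = degree (Irr T x)"
    and "finite {y \<in> L. eval (Irr T x) y = \<zero>}"
proof -
  let ?L = "R\<lparr>carrier := L\<rparr>"
  interpret LF: field ?L
    using subfield_iff(2)[OF L_subfield] .
  note Lr = subfieldE(1)[OF L_subfield]
  note poly_L = univ_poly_consistent[OF Lr, symmetric]
  define p q where "p = Irr T x" and "q = Irr k x"
  have p: "p \<in> carrier (T[X])" "pirreducible T p" "eval p x = \<zero>"
    unfolding p_def using IrrE[OF interD(1)[OF T] L_carrier[OF x] algebraic_inter[OF T x]] by auto
  have q: "q \<in> carrier (k[X])" "pirreducible k q" "eval q x = \<zero>"
    unfolding q_def using IrrE[OF k_subfield L_carrier[OF x] algebraic_inter[OF k_inter x]] by auto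
  have mono: "carrier (K[X]) \<subseteq> carrier (K'[X])" if "K \<subseteq> K'" for K K' :: "'a set"
    using that by (intro subsetI) (auto simp flip: univ_poly_carrier simp: polynomial_def)
  have pL: "p \<in> carrier (poly_ring ?L)" and qL: "q \<in> carrier (poly_ring ?L)"
    using p(1) q(1) mono[OF interD(3)[OF T]] mono[OF k_subset] by (auto simp flip: poly_L)
  have q0: "q \<noteq> []"
    using pirreducibleE(1)[OF subfieldE(1)[OF k_subfield] q(1,2)] .
  have "LF.splitted q"
    using galois q x unfolding galois_extension_def normal_extension_def by blast
  have "q \<in> carrier (T[X])"
    using q(1) mono[OF interD(2)[OF T]] by blast
  then have "p pdivides q"
    unfolding p_def
    using Irr_minimal[OF interD(1)[OF T] L_carrier[OF x] algebraic_inter[OF T x]] q(3) by blast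
  \<comment> \<open>Divisibility over the ambient field is transferred to polynomials over
    \<open>L\<close>, where the multiset of roots is formed.\<close>
  then have pq: "p pdivides\<^bsub>?L\<^esub> q"
    using pL qL pdivides_iff_shell[OF L_subfield, of p q] unfolding pdivides_def
    by (simp add: poly_L)
  then have split: "LF.splitted p"
    using LF.pdivides_imp_splitted[OF pL qL q0 \<open>LF.splitted q\<close>] by blast
  interpret C: algebraic_closure "alg_closure" "indexed_const ` carrier R"
    by (rule alg_closureE(1))
  have C: "field alg_closure"
    by (rule C.field_axioms)
  have hom: "indexed_const \<in> ring_hom ?L alg_closure"
    using alg_closureE(2) L_carrier unfolding ring_hom_def by auto
  have count_q: "count (LF.roots q) a \<le> 1" for a
  proof (cases "a \<in> L")
    case True
    \<comment> \<open>Separability bounds multiplicities in the algebraic closure, and passing to it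
      cannot lower them.\<close>
    have "LF.alg_mult q a \<le> C.alg_mult (map indexed_const q) (indexed_const a)"
      using LF.alg_mult_hom_le[OF hom C qL q0] True by simp
    also have "\<dots> \<le> 1"
    proof -
      have "indexed_const a \<in> carrier alg_closure"
        using ring_hom_memE(1)[OF alg_closureE(2)] L_carrier[OF True] by blast
      then show ?thesis
        using galois x
        unfolding galois_extension_def separable_extension_def separable_element_def q_def by blast
    qed
    finally show ?thesis
      using LF.alg_mult_eq_count_roots[OF qL] by simp
  next
    case False
    \<comment> \<open>\<open>alg_mult\<close> is zero by definition at points outside the
      carrier.\<close>
    then have "LF.alg_mult q a = 0"
      unfolding LF.alg_mult_def by simp
    then show ?thesis
      using LF.alg_mult_eq_count_roots[OF qL] by simp
  qed
  have "LF.roots p \<subseteq># LF.roots q"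
    using LF.pdivides_imp_roots_incl[OF pL qL q0 pq] .
  then have count_p: "count (LF.roots p) a \<le> 1" for a
    using count_q by (meson le_trans mset_subset_eq_count)
  have "p \<noteq> []"
    using pirreducibleE(1)[OF subfieldE(1)[OF interD(1)[OF T]] p(1,2)] .
  then have set: "set_mset (LF.roots p) = {y \<in> L. eval p y = \<zero>}"
    using LF.roots_mem_iff_is_root[OF pL] unfolding LF.is_root_def by (auto simp: eval_consistent[OF Lr])
  have "degree p = (\<Sum>a\<in>set_mset (LF.roots p). count (LF.roots p) a)"
    using split unfolding LF.splitted_def by (simp add: size_multiset_overloaded_eq)
  also have "\<dots> = (\<Sum>a\<in>set_mset (LF.roots p). 1)"
  proof (rule sum.cong)
    fix a assume "a \<in># LF.roots p"
    then show "count (LF.roots p) a = 1"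
      using count_p[of a] by (simp add: le_antisym flip: count_greater_zero_iff)
  qed simp
  finally show "card {y \<in> L. eval (Irr T x) y = \<zero>} = degree (Irr T x)"
    using set by (simp add: p_def)
  show "finite {y \<in> L. eval (Irr T x) y = \<zero>}"
    using set finite_set_mset[of "LF.roots p"] by (simp add: p_def)
qed

text \<open>Having as many roots as its degree, \<open>Irr T x\<close> is linear, and the root of a
  linear polynomial lies in the field of its coefficients.\<close>

lemma mem_of_single_root:
  assumes T: "T \<in> inter" and x: "x \<in> L" and single: "\<And>y. y \<in> L \<Longrightarrow> eval (Irr T x) y = \<zero> \<Longrightarrow> y = x"
  shows "x \<in> T"
proof -
  note irr = IrrE[OF interD(1)[OF T] L_carrier[OF x] algebraic_inter[OF T x]]
  have "{y \<in> L. eval (Irr T x) y = \<zero>} = {x}"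
    using single irr(4) x by blast
  then have deg: "degree (Irr T x) = 1"
    using card_roots_Irr(1)[OF T x] by simp
  define r where "r = \<ominus> (inv (lead_coeff (Irr T x)) \<otimes> const_term (Irr T x))"
  have "r \<in> T" "eval (Irr T x) r = \<zero>"
    using degree_one_root[OF interD(1)[OF T] irr(1) deg] subfield_closed(4)[OF interD(1)[OF T]]
    unfolding r_def by auto
  then show ?thesis
    using single interD(3)[OF T] by blast
qed

lemma simple_extension_inter:
  assumes T: "T \<in> inter" and x: "x \<in> L"
  shows "simple_extension T x \<in> inter" "T \<subseteq> simple_extension T x" "x \<in> simple_extension T x"
proof -
  note T' = interD[OF T]
  show sub: "T \<subseteq> simple_extension T x"
    using simple_extension_incl[OF T'(4) L_carrier[OF x]] .
  show "x \<in> simple_extension T x"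
    using simple_extension_mem[OF subfieldE(1)[OF T'(1)] L_carrier[OF x]] .
  have "simple_extension T x \<subseteq> L"
    using simple_extension_subring_incl[OF subfieldE(1)[OF L_subfield] T'(3) x] .
  then show "simple_extension T x \<in> inter"
    using simple_extension_is_subfield[OF T'(1) L_carrier[OF x]] algebraic_inter[OF T x] sub T'(2)
    unfolding intermediate_fields_def by auto
qed

text \<open>The classical choice \<theta> = \<alpha> + c\<beta> with \<open>c\<close> outside a
  finite set. Conjugations replace the usual gcd argument: a second root \<open>b\<close> of the
  minimal polynomial of \<beta> over k(\<theta>) would force \<open>c\<close> to be a forbidden
  value.\<close>

lemma simple_extension_of_two:
  assumes "infinite k" and \<alpha>: "\<alpha> \<in> L" and \<beta>: "\<beta> \<in> L"
  obtains \<theta> where "\<theta> \<in> L" "\<alpha> \<in> simple_extension k \<theta>" "\<beta> \<in> simple_extension k \<theta>"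
proof -
  define A B where "A = {y \<in> L. eval (Irr k \<alpha>) y = \<zero>}" and "B = {y \<in> L. eval (Irr k \<beta>) y = \<zero>}"
  \<comment> \<open>These are the values of \<open>c\<close> for which a + cb = \<alpha> + c\<beta>
    has a solution with conjugates \<open>a\<close> of \<alpha> and \<open>b\<close> of \<beta>,
    \<open>b\<close> different from \<beta>.\<close>
  have "finite ((\<lambda>(a, b). (a \<ominus> \<alpha>) \<otimes> inv (\<beta> \<ominus> b)) ` (A \<times> (B - {\<beta>})))"
    using card_roots_Irr(2)[OF k_inter] \<alpha> \<beta> unfolding A_def B_def by simp
  then obtain c where c: "c \<in> k"
    and avoid: "c \<notin> (\<lambda>(a, b). (a \<ominus> \<alpha>) \<otimes> inv (\<beta> \<ominus> b)) ` (A \<times> (B - {\<beta>}))"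
    using \<open>infinite k\<close> by (meson finite_subset subsetI)
  note Lc = subfield_closed[OF L_subfield]
  have cL: "c \<in> L"
    using c k_subset by blast
  note in_carrier = L_carrier[OF \<alpha>] L_carrier[OF \<beta>] L_carrier[OF cL]
  define \<theta> where "\<theta> = \<alpha> \<oplus> c \<otimes> \<beta>"
  have \<theta>: "\<theta> \<in> L"
    unfolding \<theta>_def using \<alpha> \<beta> cL Lc by simp
  define F where "F = simple_extension k \<theta>"
  have F: "F \<in> inter" "\<theta> \<in> F"
    unfolding F_def using simple_extension_inter[OF k_inter \<theta>] by auto
  note Fc = subfield_closed[OF interD(1)[OF F(1)]]
  have \<alpha>_eq: "\<alpha> = \<theta> \<oplus> \<ominus> (c \<otimes> \<beta>)"
    unfolding \<theta>_def using in_carrier by algebra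
  have cF: "c \<in> F"
    using c interD(2)[OF F(1)] by blast
  have "\<beta> \<in> F"
  proof (rule mem_of_single_root[OF F(1) \<beta>])
    fix b assume b: "b \<in> L" "eval (Irr F \<beta>) b = \<zero>"
    define M where "M = simple_extension F \<beta>"
    have M: "M \<in> inter" "F \<subseteq> M" "\<beta> \<in> M"
      unfolding M_def using simple_extension_inter[OF F(1) \<beta>] by auto
    note Mc = subfield_closed[OF interD(1)[OF M(1)]]
    \<comment> \<open>\<phi> fixes \<theta> and moves \<beta> to \<open>b\<close>; applying it to
      \<theta> = \<alpha> + c\<beta> determines the image of \<alpha>.\<close>
    obtain \<phi> where hom: "\<phi> \<in> ring_hom (R\<lparr>carrier := M\<rparr>) R"
      and fix_F: "\<And>c. c \<in> F \<Longrightarrow> \<phi> c = c" and \<phi>\<beta>: "\<phi> \<beta> = b"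
      using exists_conjugation[OF interD(1)[OF F(1)] in_carrier(2) algebraic_inter[OF F(1) \<beta>]
          L_carrier[OF b(1)] b(2)] unfolding M_def by blast
    have \<alpha>M: "\<alpha> \<in> M"
      unfolding \<alpha>_eq using M(2,3) cF F(2) by (intro Mc(4,6,7)) auto
    have \<phi>0: "\<phi> \<zero> = \<zero>"
      using fix_F Fc(2) by blast
    have root: "eval (Irr k z) (\<phi> z) = \<zero>" if z: "z \<in> M" for z
    proof -
      have zL: "z \<in> L"
        using z interD(3)[OF M(1)] by blast
      note irr = IrrE[OF k_subfield L_carrier[OF zL] algebraic_inter[OF k_inter zL]]
      have "\<phi> (eval (Irr k z) z) = eval (Irr k z) (\<phi> z)"
        using hom_eval_fixed[OF subfieldE(1)[OF interD(1)[OF M(1)]] hom interD(2)[OF M(1)] _ irr(1) z]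
          fix_F interD(2)[OF F(1)] by blast
      then show ?thesis
        using irr(4) \<phi>0 by simp
    qed
    have bB: "b \<in> B"
      unfolding B_def using root[OF M(3)] \<phi>\<beta> b by simp
    have "\<phi> \<theta> = \<phi> \<alpha> \<oplus> \<phi> c \<otimes> \<phi> \<beta>"
    proof -
      have "\<phi> (\<alpha> \<oplus> c \<otimes> \<beta>) = \<phi> \<alpha> \<oplus> \<phi> (c \<otimes> \<beta>)"
        using ring_hom_memE(3)[OF hom, of \<alpha> "c \<otimes> \<beta>"] \<alpha>M cF M(2,3) Mc(7) by auto
      moreover have "\<phi> (c \<otimes> \<beta>) = \<phi> c \<otimes> \<phi> \<beta>"
        using ring_hom_memE(2)[OF hom, of c \<beta>] cF M(2,3) by auto
      ultimately show ?thesis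
        by (simp add: \<theta>_def)
    qed
    then have eq: "\<theta> = \<phi> \<alpha> \<oplus> c \<otimes> b"
      using fix_F F(2) cF \<phi>\<beta> by simp
    have \<phi>\<alpha>: "\<phi> \<alpha> \<in> carrier R"
      using ring_hom_memE(1)[OF hom] \<alpha>M by simp
    \<comment> \<open>\<phi> is only known to map into the ambient field; this formula shows that
      the image of \<alpha> lies in \<open>L\<close>.\<close>
    have "\<phi> \<alpha> = \<theta> \<oplus> \<ominus> (c \<otimes> b)"
      unfolding eq using \<phi>\<alpha> in_carrier L_carrier[OF b(1)] by algebra
    then have "\<phi> \<alpha> \<in> L"
      using \<theta> cL b(1) Lc by simp
    then have \<alpha>A: "\<phi> \<alpha> \<in> A"
      unfolding A_def using root[OF \<alpha>M] by simp
    show "b = \<beta>"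
    proof (rule ccontr)
      assume "b \<noteq> \<beta>"
      then have ne: "\<beta> \<ominus> b \<noteq> \<zero>" "\<beta> \<ominus> b \<in> carrier R"
        using in_carrier L_carrier[OF b(1)] by auto
      have "\<phi> \<alpha> \<ominus> \<alpha> = c \<otimes> (\<beta> \<ominus> b)"
      proof -
        have "\<phi> \<alpha> = (\<alpha> \<oplus> c \<otimes> \<beta>) \<oplus> \<ominus> (c \<otimes> b)"
          using \<open>\<phi> \<alpha> = \<theta> \<oplus> \<ominus> (c \<otimes> b)\<close> by (simp add: \<theta>_def)
        then show ?thesis
          using in_carrier L_carrier[OF b(1)] by algebra
      qed
      then have "(\<phi> \<alpha> \<ominus> \<alpha>) \<otimes> inv (\<beta> \<ominus> b) = c"
        using ne in_carrier by (simp add: m_assoc field_Units)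
      then show False
        using avoid \<alpha>A bB \<open>b \<noteq> \<beta>\<close> by force
    qed
  qed
  moreover have "\<alpha> \<in> F"
    using \<alpha>_eq \<open>\<beta> \<in> F\<close> cF F(2) Fc by simp
  ultimately show thesis
    using that \<theta> unfolding F_def by blast
qed

text \<open>If \<open>k\<close> is finite, so is \<open>L\<close>, and a generator of its
  multiplicative group is primitive. If \<open>k\<close> is infinite, an element of maximal degree
  is primitive, since adjoining any further element cannot raise the degree.\<close>

lemma primitive_element:
  obtains \<theta> where "\<theta> \<in> L" "simple_extension k \<theta> = L"
proof (cases "finite k")
  case True
  obtain n where "dimension n k L"
    using finite_dim by blast
  then obtain Us where "set Us \<subseteq> carrier R" "Span k Us = L"
    using exists_base[OF k_subfield] by blast
  then have "finite L"
    using finite_Span[OF k_subfield True] by blast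
  let ?L = "R\<lparr>carrier := L\<rparr>"
  interpret LF: field ?L
    using subfield_iff(2)[OF L_subfield] .
  obtain a where a: "a \<in> L" and gen: "L - {\<zero>} = {a [^]\<^bsub>?L\<^esub> i | i::nat. i \<in> UNIV}"
    using LF.finite_field_mult_group_has_gen \<open>finite L\<close> by auto
  note ext = simple_extension_inter[OF k_inter a]
  note closed = subfield_closed[OF interD(1)[OF ext(1)]]
  have "a [^]\<^bsub>?L\<^esub> i \<in> simple_extension k a" for i :: nat
  proof (induction i)
    case 0
    then show ?case
      using closed(3) by simp
  next
    case (Suc i)
    then show ?case
      using closed(7)[OF Suc ext(3)] by simp
  qed
  then have "L - {\<zero>} \<subseteq> simple_extension k a"
    unfolding gen by blast
  then have "L \<subseteq> simple_extension k a"
    using closed(2) by (simp add: Diff_subset_conv insert_absorb)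
  then have "simple_extension k a = L"
    using interD(3)[OF ext(1)] by blast
  then show thesis
    using that a by blast
next
  case False
  obtain n where n: "dimension n k L"
    using finite_dim by blast
  have dim: "dimension (degree (Irr k x)) k (simple_extension k x)" if "x \<in> L" for x
    using dimension_simple_extension[OF k_subfield L_carrier[OF that] algebraic_inter[OF k_inter that]] .
  have "degree (Irr k x) \<le> n" if "x \<in> L" for x
    using dimension_mono(1)[OF k_subfield dim[OF that] n] interD(3)[OF simple_extension_inter(1)[OF k_inter that]]
    by blast
  \<comment> \<open>Degrees are bounded by \<open>[L:k]\<close>, so a largest one exists; zero
    witnesses that \<open>L\<close> is nonempty.\<close>
  then have "\<exists>x. x \<in> L \<and> (\<forall>y. y \<in> L \<longrightarrow> degree (Irr k y) \<le> degree (Irr k x))"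
    using ex_has_greatest_nat[of "\<lambda>x. x \<in> L" \<zero> "\<lambda>x. degree (Irr k x)" "Suc n"]
      subfield_closed(2)[OF L_subfield] by (auto simp: less_Suc_eq_le)
  then obtain x where x: "x \<in> L" and max: "\<And>y. y \<in> L \<Longrightarrow> degree (Irr k y) \<le> degree (Irr k x)"
    by blast
  have "y \<in> simple_extension k x" if y: "y \<in> L" for y
  proof -
    \<comment> \<open>k(\<theta>) contains k(x), and by maximality both have the same dimension, so
      they coincide and contain \<open>y\<close>.\<close>
    obtain \<theta> where \<theta>: "\<theta> \<in> L" "x \<in> simple_extension k \<theta>" "y \<in> simple_extension k \<theta>"
      using simple_extension_of_two[OF False x y] .
    note \<theta>_ext = simple_extension_inter[OF k_inter \<theta>(1)]
    have sub: "simple_extension k x \<subseteq> simple_extension k \<theta>"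
      using simple_extension_subring_incl[OF subfieldE(1)[OF interD(1)[OF \<theta>_ext(1)]] \<theta>_ext(2) \<theta>(2)] .
    then have "degree (Irr k x) = degree (Irr k \<theta>)"
      using dimension_mono(1)[OF k_subfield dim[OF x] dim[OF \<theta>(1)]] max[OF \<theta>(1)] by simp
    then show ?thesis
      using dimension_mono(2)[OF k_subfield dim[OF x] dim[OF \<theta>(1)] sub] \<theta>(3) by simp
  qed
  then have "simple_extension k x = L"
    using interD(3)[OF simple_extension_inter(1)[OF k_inter x]] by blast
  then show thesis
    using that x by blast
qed

end

section \<open>The Galois correspondence\<close>

context finite_galois
begin

abbreviation G :: "('a \<Rightarrow> 'a) monoid"
  where "G \<equiv> galois_group R k L"

text \<open>Automorphisms are functions extensional on \<open>L\<close> whatever the base field, so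
  for an intermediate field \<open>T\<close> this is the carrier of
  \<open>galois_group R T L\<close>.\<close>

definition gal :: "'a set \<Rightarrow> ('a \<Rightarrow> 'a) set"
  where "gal T = {\<alpha> \<in> carrier G. \<forall>x\<in>T. \<alpha> x = x}"

definition fixed :: "('a \<Rightarrow> 'a) set \<Rightarrow> 'a set"
  where "fixed H = {x \<in> L. \<forall>\<alpha>\<in>H. \<alpha> x = x}"

lemmas L_closed = subfield_closed[OF L_subfield]

section \<open>The automorphisms of L over k form a group\<close>

lemma carrier_G_iff:
  "\<alpha> \<in> carrier G \<longleftrightarrow> \<alpha> \<in> Bij L \<and> (\<forall>x\<in>L. \<forall>y\<in>L. \<alpha> (x \<oplus> y) = \<alpha> x \<oplus> \<alpha> y) \<and>
    (\<forall>x\<in>L. \<forall>y\<in>L. \<alpha> (x \<otimes> y) = \<alpha> x \<otimes> \<alpha> y) \<and> (\<forall>x\<in>k. \<alpha> x = x)"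
proof -
  have "\<one> \<in> k"
    using subfield_closed(3)[OF k_subfield] .
  then show ?thesis
    unfolding galois_group_def ring_hom_def by (auto dest: Bij_imp_funcset)
qed

lemma automorphism:
  assumes "\<alpha> \<in> carrier G"
  shows "\<And>x. x \<in> L \<Longrightarrow> \<alpha> x \<in> L"
    and "\<And>x y. x \<in> L \<Longrightarrow> y \<in> L \<Longrightarrow> \<alpha> (x \<oplus> y) = \<alpha> x \<oplus> \<alpha> y"
    and "\<And>x y. x \<in> L \<Longrightarrow> y \<in> L \<Longrightarrow> \<alpha> (x \<otimes> y) = \<alpha> x \<otimes> \<alpha> y"
    and "\<And>x. x \<in> k \<Longrightarrow> \<alpha> x = x"
    and "bij_betw \<alpha> L L" and "\<alpha> \<in> extensional L"
  using assms unfolding carrier_G_iff by (auto simp: Bij_def dest: bij_betw_apply)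

lemma automorphism_inverse:
  assumes s: "\<alpha> \<in> carrier G"
  shows "\<And>x. x \<in> L \<Longrightarrow> \<alpha> (\<ominus> x) = \<ominus> \<alpha> x"
    and "\<And>x. x \<in> L \<Longrightarrow> x \<noteq> \<zero> \<Longrightarrow> \<alpha> (inv x) = inv (\<alpha> x)"
proof -
  note auto = automorphism[OF s]
  have s0: "\<alpha> \<zero> = \<zero>" and s1: "\<alpha> \<one> = \<one>"
    using auto(4) subfield_closed(2,3)[OF k_subfield] by auto
  fix x assume x: "x \<in> L"
  have "\<alpha> (\<ominus> x) \<oplus> \<alpha> x = \<zero>"
    using auto(2)[of "\<ominus> x" x] x L_closed(4)[OF x] L_carrier s0 by (simp add: l_neg)
  then show "\<alpha> (\<ominus> x) = \<ominus> \<alpha> x"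
    using minus_equality[of "\<alpha> (\<ominus> x)" "\<alpha> x"] auto(1) x L_closed(4)[OF x] L_carrier by simp
  assume x0: "x \<noteq> \<zero>"
  note ix = L_closed(5)[OF x x0]
  have "\<alpha> x \<otimes> \<alpha> (inv x) = \<one>"
    using auto(3)[of x "inv x"] x ix x0 L_carrier s1 by (simp add: field_Units)
  then show "\<alpha> (inv x) = inv (\<alpha> x)"
    using comm_inv_char[of "\<alpha> x" "\<alpha> (inv x)"] auto(1) x ix L_carrier by simp
qed

lemma subgroup_galois: "subgroup (carrier G) (BijGroup L)"
proof -
  interpret B: group "BijGroup L"
    by (rule group_BijGroup)
  show ?thesis
  proof (rule B.subgroupI)
    show "carrier G \<subseteq> carrier (BijGroup L)"
      by (auto simp: carrier_G_iff BijGroup_def)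
    have "(\<lambda>x\<in>L. x) \<in> carrier G"
      using k_subset L_closed by (auto simp: carrier_G_iff id_Bij)
    then show "carrier G \<noteq> {}"
      by blast
  next
    fix \<alpha> assume s: "\<alpha> \<in> carrier G"
    note auto = automorphism[OF s]
    have B: "\<alpha> \<in> Bij L"
      using s by (simp add: carrier_G_iff)
    \<comment> \<open>Inverses in \<open>BijGroup L\<close> are extensional, so the inverse map is
      restricted to \<open>L\<close>.\<close>
    define \<beta> where "\<beta> = (\<lambda>x\<in>L. inv_into L \<alpha> x)"
    have \<beta>_eq: "\<beta> (\<alpha> x) = x" if "x \<in> L" for x
      using that auto(1,5) by (simp add: \<beta>_def bij_betw_def inv_into_f_f)
    have surj: "\<exists>u\<in>L. x = \<alpha> u" if "x \<in> L" for x
      using that auto(5) by (auto simp: bij_betw_def)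
    have "\<beta> \<in> carrier G"
      unfolding carrier_G_iff
    proof (intro conjI ballI)
      show "\<beta> \<in> Bij L"
        unfolding \<beta>_def using B by (rule restrict_inv_into_Bij)
    next
      fix x y assume "x \<in> L" "y \<in> L"
      then obtain u v where uv: "u \<in> L" "v \<in> L" "x = \<alpha> u" "y = \<alpha> v"
        using surj by metis
      then show "\<beta> (x \<oplus> y) = \<beta> x \<oplus> \<beta> y" "\<beta> (x \<otimes> y) = \<beta> x \<otimes> \<beta> y"
        using \<beta>_eq L_closed(6,7) by (simp_all flip: auto(2,3))
    next
      fix x assume "x \<in> k"
      then show "\<beta> x = x"
        using \<beta>_eq[of x] auto(4) k_subset by auto
    qed
    then show "inv\<^bsub>BijGroup L\<^esub> \<alpha> \<in> carrier G"
      using inv_BijGroup[OF B] by (simp add: \<beta>_def)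
  next
    fix \<alpha> \<beta> assume s: "\<alpha> \<in> carrier G" and t: "\<beta> \<in> carrier G"
    have "\<alpha> \<in> Bij L" "\<beta> \<in> Bij L"
      using s t by (simp_all add: carrier_G_iff)
    moreover have "compose L \<alpha> \<beta> \<in> carrier G"
      using automorphism(1-4)[OF s] automorphism(1-4)[OF t] k_subset L_closed(6,7)
      by (auto simp: carrier_G_iff compose_def subset_iff calculation compose_Bij[unfolded compose_def])
    ultimately show "\<alpha> \<otimes>\<^bsub>BijGroup L\<^esub> \<beta> \<in> carrier G"
      by (simp add: BijGroup_def)
  qed
qed

lemma group_G: "group G"
proof -
  have "G = (BijGroup L)\<lparr>carrier := carrier G\<rparr>"
    by (simp add: galois_group_def)
  then show ?thesis
    using subgroup.subgroup_is_group[OF subgroup_galois group_BijGroup] by metis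
qed

sublocale G: group G
  by (rule group_G)

lemma mult_G:
  assumes "\<alpha> \<in> carrier G" "\<beta> \<in> carrier G" "x \<in> L"
  shows "(\<alpha> \<otimes>\<^bsub>G\<^esub> \<beta>) x = \<alpha> (\<beta> x)"
proof -
  have "\<alpha> \<in> Bij L" "\<beta> \<in> Bij L"
    using assms by (simp_all add: carrier_G_iff)
  then show ?thesis
    using \<open>x \<in> L\<close> by (simp add: galois_group_def BijGroup_def compose_def)
qed

lemma one_G: "x \<in> L \<Longrightarrow> \<one>\<^bsub>G\<^esub> x = x"
  by (simp add: galois_group_def BijGroup_def)

lemma G_eqI:
  assumes "\<alpha> \<in> carrier G" "\<beta> \<in> carrier G" "\<And>x. x \<in> L \<Longrightarrow> \<alpha> x = \<beta> x"
  shows "\<alpha> = \<beta>"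
  using extensionalityI[OF automorphism(6)[OF assms(1)] automorphism(6)[OF assms(2)]] assms(3) .

lemma subgroup_gal:
  assumes "T \<subseteq> L"
  shows "subgroup (gal T) G"
proof (rule G.subgroupI)
  have "\<one>\<^bsub>G\<^esub> \<in> gal T"
    using assms one_G unfolding gal_def by auto
  then show "gal T \<noteq> {}"
    by blast
  show "gal T \<subseteq> carrier G"
    unfolding gal_def by auto
next
  fix \<alpha> assume s: "\<alpha> \<in> gal T"
  have "(inv\<^bsub>G\<^esub> \<alpha>) x = x" if "x \<in> T" for x
    using mult_G[of "inv\<^bsub>G\<^esub> \<alpha>" \<alpha> x] s that assms one_G unfolding gal_def by auto
  then show "inv\<^bsub>G\<^esub> \<alpha> \<in> gal T"
    using s unfolding gal_def by auto
next
  fix \<alpha> \<beta> assume "\<alpha> \<in> gal T" "\<beta> \<in> gal T"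
  then show "\<alpha> \<otimes>\<^bsub>G\<^esub> \<beta> \<in> gal T"
    using assms mult_G unfolding gal_def by (auto simp: subset_iff)
qed

lemma fixed_inter:
  assumes "H \<subseteq> carrier G"
  shows "fixed H \<in> inter"
proof -
  have "k \<subseteq> fixed H"
    using assms k_subset automorphism(4) unfolding fixed_def by blast
  moreover have "subfield (fixed H) R"
  proof (rule subfieldI_closed)
    show "fixed H \<subseteq> carrier R"
      unfolding fixed_def using L_carrier by auto
    show "\<one> \<in> fixed H"
      using \<open>k \<subseteq> fixed H\<close> subfield_closed(3)[OF k_subfield] by blast
  next
    fix x assume "x \<in> fixed H"
    then have x: "x \<in> L" "\<And>\<alpha>. \<alpha> \<in> H \<Longrightarrow> \<alpha> x = x"
      unfolding fixed_def by auto
    note H = subsetD[OF assms]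
    show "\<ominus> x \<in> fixed H"
      unfolding fixed_def by (simp add: automorphism_inverse(1)[OF H] x L_closed(4))
    show "inv x \<in> fixed H" if "x \<noteq> \<zero>"
      unfolding fixed_def by (simp add: automorphism_inverse(2)[OF H] x L_closed(5) that)
    fix y assume "y \<in> fixed H"
    then have y: "y \<in> L" "\<And>\<alpha>. \<alpha> \<in> H \<Longrightarrow> \<alpha> y = y"
      unfolding fixed_def by auto
    show "x \<oplus> y \<in> fixed H"
      unfolding fixed_def by (simp add: automorphism(2)[OF H] x y L_closed(6))
    show "x \<otimes> y \<in> fixed H"
      unfolding fixed_def by (simp add: automorphism(3)[OF H] x y L_closed(7))
  qed
  ultimately show ?thesis
    unfolding intermediate_fields_def fixed_def by auto
qed

section \<open>Counting automorphisms by roots\<close>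

lemma eval_automorphism:
  assumes "\<alpha> \<in> gal T" "T \<in> inter" "p \<in> carrier (T[X])" "x \<in> L"
  shows "\<alpha> (eval p x) = eval p (\<alpha> x)"
proof (rule hom_eval_fixed)
  have "\<alpha> \<in> carrier G"
    using assms(1) unfolding gal_def by simp
  then show "\<alpha> \<in> ring_hom (R\<lparr>carrier := L\<rparr>) R"
    using automorphism(1-4) L_carrier subfield_closed(3)[OF k_subfield]
    by (intro ring_hom_memI) auto
  show "\<alpha> c = c" if "c \<in> T" for c
    using that assms(1) unfolding gal_def by simp
qed (use assms interD(3) subfieldE(1)[OF L_subfield] in auto)

lemma eval_closed:
  assumes "T \<in> inter" "p \<in> carrier (T[X])" "x \<in> L"
  shows "eval p x \<in> L"
  using simple_extension_as_eval_img[OF interD(4)[OF assms(1)] L_carrier[OF assms(3)]]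
    interD(3)[OF simple_extension_inter(1)[OF assms(1,3)]] assms(2) by blast

text \<open>As \<theta> generates \<open>L\<close> over \<open>T\<close>, an automorphism is
  determined by the image of \<theta>, which is a conjugate; each conjugate in \<open>L\<close>
  arises from \<open>exists_conjugation\<close>.\<close>

lemma bij_betw_gal_roots:
  assumes T: "T \<in> inter" and \<theta>: "\<theta> \<in> L" and prim: "simple_extension T \<theta> = L"
  shows "bij_betw (\<lambda>\<alpha>. \<alpha> \<theta>) (gal T) {y \<in> L. eval (Irr T \<theta>) y = \<zero>}"
proof -
  note T' = interD[OF T]
  note irr = IrrE[OF T'(1) L_carrier[OF \<theta>] algebraic_inter[OF T \<theta>]]
  have gen: "\<exists>p\<in>carrier (T[X]). x = eval p \<theta>" if "x \<in> L" for x
    using that simple_extension_as_eval_img[OF T'(4) L_carrier[OF \<theta>]] prim by auto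
  have zero: "\<alpha> \<zero> = \<zero>" if "\<alpha> \<in> gal T" for \<alpha>
    using that subfield_closed(2)[OF T'(1)] unfolding gal_def by blast
  show ?thesis
  proof (rule bij_betw_imageI)
    show "inj_on (\<lambda>\<alpha>. \<alpha> \<theta>) (gal T)"
    proof (rule inj_onI)
      fix \<alpha> \<beta> assume st: "\<alpha> \<in> gal T" "\<beta> \<in> gal T" "\<alpha> \<theta> = \<beta> \<theta>"
      show "\<alpha> = \<beta>"
      proof (rule G_eqI)
        fix x assume "x \<in> L"
        then obtain p where "p \<in> carrier (T[X])" "x = eval p \<theta>"
          using gen by blast
        then show "\<alpha> x = \<beta> x"
          using eval_automorphism[OF st(1) T _ \<theta>] eval_automorphism[OF st(2) T _ \<theta>] st(3) by simp
      qed (use st in \<open>auto simp: gal_def\<close>)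
    qed
    show "(\<lambda>\<alpha>. \<alpha> \<theta>) ` gal T = {y \<in> L. eval (Irr T \<theta>) y = \<zero>}"
    proof (intro equalityI subsetI)
      fix y assume "y \<in> (\<lambda>\<alpha>. \<alpha> \<theta>) ` gal T"
      then obtain \<alpha> where s: "\<alpha> \<in> gal T" "y = \<alpha> \<theta>"
        by blast
      have "\<alpha> (eval (Irr T \<theta>) \<theta>) = eval (Irr T \<theta>) y"
        using eval_automorphism[OF s(1) T irr(1) \<theta>] s(2) by simp
      then show "y \<in> {y \<in> L. eval (Irr T \<theta>) y = \<zero>}"
        using irr(4) zero[OF s(1)] s automorphism(1) \<theta> unfolding gal_def by simp
    next
      fix y assume "y \<in> {y \<in> L. eval (Irr T \<theta>) y = \<zero>}"
      then have y: "y \<in> L" "eval (Irr T \<theta>) y = \<zero>"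
        by auto
      obtain \<phi> where hom: "\<phi> \<in> ring_hom (R\<lparr>carrier := L\<rparr>) R"
        and \<phi>_eval: "\<And>p. p \<in> carrier (T[X]) \<Longrightarrow> \<phi> (eval p \<theta>) = eval p y"
        and fix_T: "\<And>c. c \<in> T \<Longrightarrow> \<phi> c = c" and \<phi>\<theta>: "\<phi> \<theta> = y"
        using exists_conjugation[OF T'(1) L_carrier[OF \<theta>] algebraic_inter[OF T \<theta>] L_carrier[OF y(1)] y(2)]
        unfolding prim by blast
      have into: "\<phi> x \<in> L" if "x \<in> L" for x
        using gen[OF that] \<phi>_eval eval_closed[OF T _ y(1)] by auto
      have inj: "inj_on \<phi> L"
        using non_trivial_field_hom_is_inj[OF hom subfield_iff(2)[OF L_subfield] field_axioms] by simp
      \<comment> \<open>An injective endomorphism permutes the finitely many roots of each minimal polynomial.\<close>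
      have onto: "x \<in> \<phi> ` L" if x: "x \<in> L" for x
      proof -
        define C where "C = {z \<in> L. eval (Irr k x) z = \<zero>}"
        note irr_x = IrrE[OF k_subfield L_carrier[OF x] algebraic_inter[OF k_inter x]]
        have "\<phi> (eval (Irr k x) z) = eval (Irr k x) (\<phi> z)" if "z \<in> L" for z
          using hom_eval_fixed[OF subfieldE(1)[OF L_subfield] hom k_subset _ irr_x(1) that]
            fix_T T'(2) by blast
        moreover have "\<phi> \<zero> = \<zero>"
          using fix_T subfield_closed(2)[OF T'(1)] by blast
        ultimately have "\<phi> ` C \<subseteq> C"
          using into unfolding C_def by force
        moreover have "inj_on \<phi> C"
          using inj by (rule inj_on_subset) (auto simp: C_def)
        ultimately have "\<phi> ` C = C"
          using card_roots_Irr(2)[OF k_inter x] unfolding C_def[symmetric]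
          by (intro endo_inj_surj)
        moreover have "x \<in> C"
          using x irr_x(4) unfolding C_def by simp
        ultimately show ?thesis
          unfolding C_def by blast
      qed
      \<comment> \<open>Restricting to \<open>L\<close> gives the extensional representative
        required of elements of the group.\<close>
      have "restrict \<phi> L \<in> Bij L"
        using inj into onto unfolding Bij_def bij_betw_def by auto
      moreover have "\<phi> (u \<oplus> v) = \<phi> u \<oplus> \<phi> v" "\<phi> (u \<otimes> v) = \<phi> u \<otimes> \<phi> v" if "u \<in> L" "v \<in> L" for u v
        using ring_hom_memE(2,3)[OF hom] that by auto
      ultimately have "restrict \<phi> L \<in> gal T"
        using fix_T T'(2,3) k_subset L_closed(6,7) unfolding gal_def carrier_G_iff by (auto simp: subset_iff)
      then show "y \<in> (\<lambda>\<alpha>. \<alpha> \<theta>) ` gal T"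
        using \<phi>\<theta> \<theta> by (intro image_eqI[of _ _ "restrict \<phi> L"]) auto
    qed
  qed
qed

lemma simple_extension_over_inter:
  assumes "T \<in> inter" "\<theta> \<in> L" "simple_extension k \<theta> = L"
  shows "simple_extension T \<theta> = L"
  using mono_simple_extension[OF interD(2)[OF assms(1)], of \<theta>]
    interD(3)[OF simple_extension_inter(1)[OF assms(1,2)]] assms(3) by blast

lemma card_gal_primitive:
  assumes T: "T \<in> inter" and \<theta>: "\<theta> \<in> L" "simple_extension k \<theta> = L"
  shows "card (gal T) = degree (Irr T \<theta>)" "finite (gal T)"
proof -
  have bij: "bij_betw (\<lambda>\<alpha>. \<alpha> \<theta>) (gal T) {y \<in> L. eval (Irr T \<theta>) y = \<zero>}"
    using bij_betw_gal_roots[OF T \<theta>(1) simple_extension_over_inter[OF T \<theta>]] .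
  then show "card (gal T) = degree (Irr T \<theta>)" "finite (gal T)"
    using bij_betw_same_card[OF bij] bij_betw_finite[OF bij] card_roots_Irr[OF T \<theta>(1)] by simp_all
qed

text \<open>A primitive element over \<open>k\<close> also generates \<open>L\<close> over
  \<open>T\<close>, so the order of \<open>gal T\<close> and \<open>[L:T]\<close> are both the
  degree of its minimal polynomial over \<open>T\<close>.\<close>

lemma dimension_gal:
  assumes T: "T \<in> inter"
  shows "dimension (card (gal T)) T L" "finite (gal T)"
proof -
  obtain \<theta> where \<theta>: "\<theta> \<in> L" "simple_extension k \<theta> = L"
    by (rule primitive_element)
  show "dimension (card (gal T)) T L" "finite (gal T)"
    using dimension_simple_extension[OF interD(1)[OF T] L_carrier[OF \<theta>(1)] algebraic_inter[OF T \<theta>(1)]]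
      card_gal_primitive[OF T \<theta>] simple_extension_over_inter[OF T \<theta>] by simp_all
qed

lemma gal_k: "gal k = carrier G"
  using automorphism(4) unfolding gal_def by auto

lemma finite_G: "finite (carrier G)"
  using dimension_gal(2)[OF k_inter] by (simp add: gal_k)

lemma order_G: "order G = (dim over k) L"
  using dimI[OF k_subfield dimension_gal(1)[OF k_inter]] by (simp add: gal_k order_def)

text \<open>\<open>T\<close> and the fixed field \<open>F\<close> have the same group, hence
  \<open>[L:T] = [L:F]\<close>, and the tower law leaves \<open>[F:T] = 1\<close>.\<close>

lemma fixed_gal:
  assumes T: "T \<in> inter"
  shows "fixed (gal T) = T"
proof -
  define F where "F = fixed (gal T)"
  have F: "F \<in> inter"
    unfolding F_def by (rule fixed_inter) (auto simp: gal_def)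
  have sub: "T \<subseteq> F"
    using interD(3)[OF T] unfolding F_def fixed_def gal_def by blast
  have "gal F = gal T"
    using sub unfolding F_def fixed_def gal_def by blast
  then have dim: "dimension (card (gal T)) F L" "dimension (card (gal T)) T L"
    using dimension_gal(1)[OF F] dimension_gal(1)[OF T] by simp_all
  note F' = interD[OF F] and T' = interD[OF T]
  \<comment> \<open>The tower law needs \<open>F\<close> to be finite over \<open>T\<close>, which
    holds for a subspace of \<open>L\<close>.\<close>
  have "subalgebra T F R"
  proof (intro subalgebra.intro subalgebra_axioms.intro)
    show "subgroup F (add_monoid R)"
      using subringE[OF subfieldE(1)[OF F'(1)]] by (intro add.subgroupI) (auto simp: a_inv_def)
    show "c \<otimes> v \<in> F" if "c \<in> T" "v \<in> F" for c v
      using that sub subfield_closed(7)[OF F'(1)] by blast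
  qed
  then have "finite_dimension T F"
    using subalbegra_incl_imp_finite_dimension[OF T'(1) finite_dimensionI[OF dim(2)]] F'(3) by blast
  then obtain d where d: "dimension d T F"
    by blast
  have "dimension (d * card (gal T)) T L"
    using telescopic_base[OF T'(1) F'(1) d dim(1)] .
  then have "d * card (gal T) = card (gal T)"
    using dimension_is_inj[OF T'(1)] dim(2) by blast
  \<comment> \<open>The identity lies in \<open>gal T\<close>, so this factor can be
    cancelled.\<close>
  moreover have "card (gal T) \<noteq> 0"
    using dimension_gal(2)[OF T] subgroup.one_closed[OF subgroup_gal[OF T'(3)]] by auto
  ultimately have "dimension 1 T F"
    using d by simp
  then show ?thesis
    using dimension_mono(2)[OF T'(1) dimension_one[OF T'(1)] _ sub] unfolding F_def by simp
qed

text \<open>The polynomial is the product of the factors X - \<alpha>(\<theta>) over \<alpha> in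
  \<open>H\<close>. Elements of \<open>H\<close> permute the factors, so its coefficients are fixed
  by \<open>H\<close>.\<close>

lemma fixed_polynomial:
  assumes H: "subgroup H G" and \<theta>: "\<theta> \<in> L"
  obtains P where "P \<in> carrier (fixed H[X])" "P \<noteq> []" "degree P = card H" "eval P \<theta> = \<zero>"
proof -
  let ?L = "R\<lparr>carrier := L\<rparr>"
  interpret LF: field ?L
    using subfield_iff(2)[OF L_subfield] .
  define U where "U = poly_ring ?L"
  interpret UP: domain U
    using LF.univ_poly_is_domain[OF LF.carrier_is_subring] unfolding U_def .
  have U_one: "\<one>\<^bsub>U\<^esub> = [\<one>]" and U_zero: "\<zero>\<^bsub>U\<^esub> = []"
    and U_carrier: "\<And>p. p \<in> carrier U \<longleftrightarrow> polynomial\<^bsub>?L\<^esub> L p"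
    and U_mult: "\<And>p q. p \<otimes>\<^bsub>U\<^esub> q = LF.poly_mult p q"
    by (simp_all add: U_def univ_poly_one univ_poly_zero univ_poly_mult univ_poly_carrier)
  note Lr = subfieldE(1)[OF L_subfield]
  note HG = subgroup.subset[OF H]
  have finH: "finite H"
    using HG finite_G by (rule finite_subset)
  define f where "f \<alpha> = [\<one>, \<ominus> \<alpha> \<theta>]" for \<alpha> :: "'a \<Rightarrow> 'a"
  have f: "f \<alpha> \<in> carrier (U)" if "\<alpha> \<in> carrier G" for \<alpha>
    using L_closed(3) L_closed(4)[OF automorphism(1)[OF that \<theta>]]
    unfolding f_def U_carrier polynomial_def by simp
  \<comment> \<open>The product is defined for arbitrary sets \<open>A\<close> of automorphisms,
    which allows induction on the factors.\<close>
  define P where "P A = finprod (U) f A" for A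
  have P_insert: "P (insert \<alpha> A) = f \<alpha> \<otimes>\<^bsub>U\<^esub> P A"
    if "finite A" "\<alpha> \<notin> A" "insert \<alpha> A \<subseteq> carrier G" for \<alpha> A
    unfolding P_def using that f by (intro UP.finprod_insert) auto
  have P_closed: "P A \<in> carrier (U)" if "A \<subseteq> carrier G" for A
    unfolding P_def using that f by (intro UP.finprod_closed) auto
  have deg: "P A \<noteq> [] \<and> degree (P A) = card A" if "finite A" "A \<subseteq> carrier G" for A
    using that
  proof (induction A)
    case empty
    then show ?case
      by (simp add: P_def U_one)
  next
    case (insert \<alpha> A)
    have "f \<alpha> \<noteq> []"
      by (simp add: f_def)
    then have "P (insert \<alpha> A) \<noteq> []"
      using P_insert insert f P_closed[of A] UP.integral[of "f \<alpha>" "P A"] by (auto simp: U_zero)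
    moreover have "degree (P (insert \<alpha> A)) = degree (f \<alpha>) + degree (P A)"
      using P_insert[OF insert(1,2,4)] LF.poly_mult_degree_eq[OF LF.carrier_is_subring, of "f \<alpha>" "P A"]
        insert f P_closed[of A] \<open>f \<alpha> \<noteq> []\<close>
      by (simp add: U_carrier U_mult)
    ultimately show ?case
      using insert by (simp add: f_def)
  qed
  \<comment> \<open>Applying \<beta> to the coefficients turns X - \<alpha>(\<theta>) into X -
    (\<beta>\<alpha>)(\<theta>).\<close>
  have map_P: "map \<beta> (P A) = finprod (U) (\<lambda>\<alpha>. f (\<beta> \<otimes>\<^bsub>G\<^esub> \<alpha>)) A"
    if "finite A" "A \<subseteq> carrier G" and b: "\<beta> \<in> carrier G" for A \<beta>
    using that(1,2)
  proof (induction A)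
    case empty
    have "\<beta> \<one> = \<one>"
      using automorphism(4)[OF b] subfield_closed(3)[OF k_subfield] by blast
    then show ?case
      by (simp add: P_def U_one)
  next
    case (insert \<alpha> A)
    have hom: "\<beta> \<in> ring_hom ?L ?L"
      using b unfolding galois_group_def by simp
    have "map \<beta> (f \<alpha>) = f (\<beta> \<otimes>\<^bsub>G\<^esub> \<alpha>)"
      using insert(4) b \<theta> automorphism(4)[OF b] subfield_closed(3)[OF k_subfield]
        automorphism_inverse(1)[OF b] automorphism(1) mult_G[OF b]
      by (simp add: f_def)
    moreover have "map \<beta> (P (insert \<alpha> A)) = map \<beta> (f \<alpha>) \<otimes>\<^bsub>U\<^esub> map \<beta> (P A)"
      using insert f P_closed[of A]
      by (simp add: P_insert poly_mult_field_hom[OF hom LF.field_axioms LF.field_axioms, folded U_def])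
    moreover have "finprod (U) (\<lambda>\<alpha>. f (\<beta> \<otimes>\<^bsub>G\<^esub> \<alpha>)) (insert \<alpha> A) =
        f (\<beta> \<otimes>\<^bsub>G\<^esub> \<alpha>) \<otimes>\<^bsub>U\<^esub> finprod (U) (\<lambda>\<alpha>. f (\<beta> \<otimes>\<^bsub>G\<^esub> \<alpha>)) A"
      using insert f b by (intro UP.finprod_insert) auto
    ultimately show ?case
      using insert by simp
  qed
  \<comment> \<open>Left multiplication by \<beta> permutes \<open>H\<close>, so it only reorders
    the factors.\<close>
  have invariant: "map \<beta> (P H) = P H" if b: "\<beta> \<in> H" for \<beta>
  proof -
    have bG: "\<beta> \<in> carrier G"
      using b HG by blast
    have inj: "inj_on ((\<otimes>\<^bsub>G\<^esub>) \<beta>) H"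
      using bG HG by (auto intro!: inj_onI simp: subset_iff)
    moreover have "(\<otimes>\<^bsub>G\<^esub>) \<beta> ` H \<subseteq> H"
      using subgroup.m_closed[OF H b] by blast
    ultimately have "(\<otimes>\<^bsub>G\<^esub>) \<beta> ` H = H"
      using endo_inj_surj[OF finH] by blast
    then have "P H = finprod (U) f ((\<otimes>\<^bsub>G\<^esub>) \<beta> ` H)"
      by (simp add: P_def)
    also have "\<dots> = finprod (U) (\<lambda>\<alpha>. f (\<beta> \<otimes>\<^bsub>G\<^esub> \<alpha>)) H"
      using f inj \<open>(\<otimes>\<^bsub>G\<^esub>) \<beta> ` H = H\<close> HG by (intro UP.finprod_reindex) auto
    finally show ?thesis
      using map_P[OF finH HG bG] by simp
  qed
  note eval_hom = ring_hom_memE[OF LF.eval_is_hom[OF LF.carrier_is_subring, of \<theta>], folded U_def]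
  have P: "set (P H) \<subseteq> L" "P H \<noteq> []" "lead_coeff (P H) \<noteq> \<zero>"
    using P_closed[OF HG] deg[OF finH HG] unfolding U_carrier polynomial_def by auto
  have "set (P H) \<subseteq> fixed H"
  proof
    fix c assume c: "c \<in> set (P H)"
    have "\<alpha> c = c" if "\<alpha> \<in> H" for \<alpha>
      using invariant[OF that] c map_eq_conv[of \<alpha> "P H" id] by simp
    then show "c \<in> fixed H"
      using c P(1) unfolding fixed_def by blast
  qed
  then have "P H \<in> carrier (fixed H[X])"
    using P unfolding sym[OF univ_poly_carrier] polynomial_def by simp
  \<comment> \<open>The identity of the group contributes the factor X - \<theta>.\<close>
  moreover have "eval (P H) \<theta> = \<zero>"
  proof -
    define H' where "H' = H - {\<one>\<^bsub>G\<^esub>}"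
    have H': "H = insert \<one>\<^bsub>G\<^esub> H'" "finite H'" "\<one>\<^bsub>G\<^esub> \<notin> H'"
      using subgroup.one_closed[OF H] finH unfolding H'_def by auto
    have PH': "P H' \<in> carrier (U)"
      using P_closed HG H'(1) by auto
    have "P H = f \<one>\<^bsub>G\<^esub> \<otimes>\<^bsub>U\<^esub> P H'"
      using P_insert[OF H'(2,3)] HG H'(1) by simp
    moreover have "LF.eval (f \<one>\<^bsub>G\<^esub> \<otimes>\<^bsub>U\<^esub> P H') \<theta> =
        LF.eval (f \<one>\<^bsub>G\<^esub>) \<theta> \<otimes>\<^bsub>?L\<^esub> LF.eval (P H') \<theta>"
      using eval_hom(2)[OF _ f PH', of "\<one>\<^bsub>G\<^esub>"] \<theta> by simp
    moreover have "LF.eval (f \<one>\<^bsub>G\<^esub>) \<theta> = \<zero>"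
      using \<theta> L_carrier[OF \<theta>] by (simp add: eval_consistent[OF Lr] f_def one_G r_neg)
    moreover have "LF.eval (P H') \<theta> \<in> L"
      using eval_hom(1)[OF _ PH'] \<theta> by simp
    ultimately show ?thesis
      using L_carrier by (simp add: eval_consistent[OF Lr])
  qed
  ultimately show thesis
    using that deg[OF finH HG] by blast
qed

text \<open>Artin's argument: the polynomial above bounds the degree of a primitive element over the
  fixed field, hence the order of \<open>gal (fixed H)\<close>, by that of \<open>H\<close>; the
  inclusion of \<open>H\<close> is clear.\<close>

lemma gal_fixed:
  assumes H: "subgroup H G"
  shows "gal (fixed H) = H"
proof -
  note HG = subgroup.subset[OF H]
  have F: "fixed H \<in> inter"
    using HG by (rule fixed_inter)
  obtain \<theta> where \<theta>: "\<theta> \<in> L" "simple_extension k \<theta> = L"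
    by (rule primitive_element)
  obtain P where P: "P \<in> carrier (fixed H[X])" "P \<noteq> []" "degree P = card H" "eval P \<theta> = \<zero>"
    using fixed_polynomial[OF H \<theta>(1)] .
  note F' = interD[OF F] and alg = algebraic_inter[OF F \<theta>(1)]
  have "Irr (fixed H) \<theta> pdivides P"
    using Irr_minimal[OF F'(1) L_carrier[OF \<theta>(1)] alg P(1,4)] .
  then have "card (gal (fixed H)) \<le> card H"
    using pdivides_imp_degree_le[OF subfieldE(1)[OF F'(1)] IrrE(1)[OF F'(1) L_carrier[OF \<theta>(1)] alg] P(1,2)]
      card_gal_primitive(1)[OF F \<theta>] P(3) by simp
  moreover have "H \<subseteq> gal (fixed H)"
    using HG unfolding gal_def fixed_def by blast
  ultimately show ?thesis
    using card_seteq[OF dimension_gal(2)[OF F]] by blast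
qed

section \<open>Lattice operations under the Galois correspondence\<close>

lemma compositum_least:
  assumes S: "S \<in> inter" and T: "T \<in> inter"
  shows "compositum R S T \<in> inter" "S \<union> T \<subseteq> compositum R S T"
    and "\<And>F. F \<in> inter \<Longrightarrow> S \<union> T \<subseteq> F \<Longrightarrow> compositum R S T \<subseteq> F"
proof -
  have ST: "S \<union> T \<subseteq> carrier R"
    using interD(4) S T by blast
  show least: "compositum R S T \<subseteq> F" if "F \<in> inter" "S \<union> T \<subseteq> F" for F
    unfolding compositum_def using generate_field_min_subfield1[OF ST interD(1)[OF that(1)] that(2)] .
  show sub: "S \<union> T \<subseteq> compositum R S T"
    unfolding compositum_def by (auto intro: generate_field.incl)
  have "compositum R S T \<subseteq> L"
    using least[OF L_inter] interD(3)[OF S] interD(3)[OF T] by simp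
  moreover have "k \<subseteq> compositum R S T"
    using interD(2)[OF S] sub by (simp add: subset_trans)
  moreover have "subfield (compositum R S T) R"
    unfolding compositum_def using generate_field_is_subfield[OF ST] .
  ultimately show "compositum R S T \<in> inter"
    unfolding intermediate_fields_def by simp
qed

lemma gal_compositum:
  assumes "S \<in> inter" "T \<in> inter"
  shows "gal (compositum R S T) = gal S \<inter> gal T"
proof
  show "gal (compositum R S T) \<subseteq> gal S \<inter> gal T"
    using compositum_least(2)[OF assms] unfolding gal_def by blast
  have "S \<union> T \<subseteq> fixed (gal S \<inter> gal T)"
    using interD(3) assms unfolding fixed_def gal_def by blast
  then have "compositum R S T \<subseteq> fixed (gal S \<inter> gal T)"
    using fixed_inter[of "gal S \<inter> gal T"] by (intro compositum_least(3)[OF assms]) (auto simp: gal_def)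
  then show "gal S \<inter> gal T \<subseteq> gal (compositum R S T)"
    unfolding fixed_def gal_def by blast
qed

lemma inter_Int:
  assumes "S \<in> inter" "T \<in> inter"
  shows "S \<inter> T \<in> inter"
proof -
  have "S \<inter> T = fixed (gal S \<union> gal T)"
    using fixed_gal[OF assms(1)] fixed_gal[OF assms(2)] unfolding fixed_def by blast
  then show ?thesis
    using fixed_inter[of "gal S \<union> gal T"] by (auto simp: gal_def)
qed

text \<open>For the harder inclusion, the fixed field of the generated subgroup lies in
  \<open>S \<inter> T\<close>; applying \<open>gal\<close> reverses this, and
  \<open>gal_fixed\<close> recovers the subgroup.\<close>

lemma gal_Int:
  assumes "S \<in> inter" "T \<in> inter"
  shows "gal (S \<inter> T) = generate G (gal S \<union> gal T)"
proof
  have ST: "gal S \<union> gal T \<subseteq> carrier G"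
    unfolding gal_def by auto
  show "generate G (gal S \<union> gal T) \<subseteq> gal (S \<inter> T)"
    using interD(3)[OF assms(1)] by (intro G.generate_subgroup_incl subgroup_gal) (auto simp: gal_def)
  have "gal S \<union> gal T \<subseteq> generate G (gal S \<union> gal T)"
    by (auto intro: generate.incl)
  then have "fixed (generate G (gal S \<union> gal T)) \<subseteq> fixed (gal S) \<inter> fixed (gal T)"
    unfolding fixed_def by blast
  then have "fixed (generate G (gal S \<union> gal T)) \<subseteq> S \<inter> T"
    by (simp add: fixed_gal assms)
  then have "gal (S \<inter> T) \<subseteq> gal (fixed (generate G (gal S \<union> gal T)))"
    unfolding gal_def by blast
  then show "gal (S \<inter> T) \<subseteq> generate G (gal S \<union> gal T)"
    by (simp add: gal_fixed G.generate_is_subgroup[OF ST])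
qed

lemma gal_eq_iff:
  assumes "S \<in> inter" "T \<in> inter"
  shows "gal S = gal T \<longleftrightarrow> S = T"
  using fixed_gal assms by metis

lemma gal_L: "gal L = {\<one>\<^bsub>G\<^esub>}"
  using G_eqI one_G subgroup.one_closed[OF subgroup_gal[OF order_refl]] unfolding gal_def by auto

lemma subgroup_iff_gal: "subgroup H G \<longleftrightarrow> (\<exists>T\<in>inter. H = gal T)"
  using gal_fixed fixed_inter subgroup.subset subgroup_gal interD(3) by metis

text \<open>The Galois correspondence reverses inclusions, so each distributive law becomes its dual.\<close>

lemma boolean_extension_iff: "boolean_extension R k L \<longleftrightarrow> boolean_subgroup_lattice G"
proof -
  have dist: "S \<inter> compositum R T U = compositum R (S \<inter> T) (S \<inter> U) \<longleftrightarrow>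
      generate G (gal S \<union> (gal T \<inter> gal U)) = generate G (gal S \<union> gal T) \<inter> generate G (gal S \<union> gal U)"
    if "S \<in> inter" "T \<in> inter" "U \<in> inter" for S T U
    using that by (simp add: gal_Int gal_compositum inter_Int compositum_least(1) flip: gal_eq_iff)
  have compl: "T \<inter> T' = k \<and> compositum R T T' = L \<longleftrightarrow>
      gal T \<inter> gal T' = {\<one>\<^bsub>G\<^esub>} \<and> generate G (gal T \<union> gal T') = carrier G"
    if "T \<in> inter" "T' \<in> inter" for T T'
    using that
    by (auto simp: gal_Int gal_compositum inter_Int compositum_least(1) k_inter L_inter gal_L gal_k
        simp flip: gal_eq_iff)
  \<comment> \<open>Every subgroup is some \<open>gal T\<close>, so quantifiers over subgroups
    become quantifiers over intermediate fields.\<close>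
  have all: "(\<forall>H. subgroup H G \<longrightarrow> Q H) \<longleftrightarrow> (\<forall>T\<in>inter. Q (gal T))"
    and ex: "(\<exists>H. subgroup H G \<and> Q H) \<longleftrightarrow> (\<exists>T\<in>inter. Q (gal T))" for Q
    unfolding subgroup_iff_gal by blast+
  show ?thesis
    unfolding boolean_extension_def distributive_extension_def boolean_subgroup_lattice_def
    by (simp add: dist compl all ex imp_conjL cong: ball_cong bex_cong)
qed

lemma boolean_extension_iff_cyclic:
  "boolean_extension R k L \<longleftrightarrow> cyclic_extension R k L \<and> squarefree_degree R k L"
  unfolding boolean_extension_iff G.boolean_subgroup_lattice_iff[OF finite_G] order_G
  using galois finite_dim by (simp add: cyclic_extension_def squarefree_degree_def over_def)

text \<open>An interval below \<open>M\<close> in a Boolean lattice is Boolean: complements are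
  obtained by intersecting with \<open>M\<close>.\<close>

lemma boolean_extension_below:
  assumes bool: "boolean_extension R k L" and M: "M \<in> inter"
  shows "boolean_extension R k M"
proof -
  have sub: "intermediate_fields R k M \<subseteq> inter"
    using interD(3)[OF M] unfolding intermediate_fields_def by auto
  have "distributive_extension R k L"
    using bool unfolding boolean_extension_def by blast
  then have dist: "S \<inter> compositum R T U = compositum R (S \<inter> T) (S \<inter> U)"
    if "S \<in> inter" "T \<in> inter" "U \<in> inter" for S T U
    using that unfolding distributive_extension_def by blast
  have "\<exists>T'\<in>intermediate_fields R k M. T \<inter> T' = k \<and> compositum R T T' = M"
    if T: "T \<in> intermediate_fields R k M" for T
  proof -
    have T': "T \<in> inter" "T \<subseteq> M"
      using T sub unfolding intermediate_fields_def by auto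
    then obtain U where U: "U \<in> inter" "T \<inter> U = k" "compositum R T U = L"
      using bool unfolding boolean_extension_def by blast
    \<comment> \<open>\<open>M \<inter> U\<close> is the complement inside \<open>M\<close>:
      distributivity gives M = M \<inter> TU = (M \<inter> T)(M \<inter> U) = T(M \<inter>
      U).\<close>
    have MU: "M \<inter> U \<in> inter"
      using inter_Int[OF M U(1)] .
    have "T \<inter> (M \<inter> U) = k"
      using T'(2) U(2) by blast
    moreover have "compositum R T (M \<inter> U) = M"
      using dist[OF M T'(1) U(1)] U(3) T'(2) interD(3)[OF M] by (simp add: Int_absorb1 Int_absorb2)
    moreover have "M \<inter> U \<in> intermediate_fields R k M"
      using MU unfolding intermediate_fields_def by blast
    ultimately show ?thesis
      by blast
  qed
  moreover have "distributive_extension R k M"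
    unfolding distributive_extension_def using dist sub by (meson subsetD)
  ultimately show ?thesis
    unfolding boolean_extension_def by blast
qed

end

theorem theorem4p19:
  fixes E :: "('a, 'b) ring_scheme"
  assumes "field E"
  shows "(\<forall>k L N. finite_extension E k L \<and> separable_extension E k L \<and> normal_closure E k L N \<and>
             cyclic_extension E k N \<and> squarefree_degree E k N \<longrightarrow>
             boolean_extension E k L) \<and>
         (\<forall>k L. finite_extension E k L \<and> galois_extension E k L \<longrightarrow>
             (boolean_extension E k L \<longleftrightarrow> cyclic_extension E k L \<and> squarefree_degree E k L))"
proof (intro conjI allI impI)
  fix k L N
  assume *: "finite_extension E k L \<and> separable_extension E k L \<and> normal_closure E k L N \<and>
    cyclic_extension E k N \<and> squarefree_degree E k N"
  \<comment> \<open>The correspondence is used for \<open>N\<close>, with \<open>L\<close> as an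
    intermediate field; \<open>squarefree_degree\<close> supplies the finiteness of \<open>N\<close>
    over \<open>k\<close>.\<close>
  then interpret finite_galois E k N
    using assms unfolding finite_galois_def finite_galois_axioms_def cyclic_extension_def squarefree_degree_def
    by blast
  have "L \<in> intermediate_fields E k N"
    using * unfolding finite_extension_def normal_closure_def field_extension_def intermediate_fields_def
    by blast
  then show "boolean_extension E k L"
    using boolean_extension_below boolean_extension_iff_cyclic * by blast
next
  fix k L
  assume "finite_extension E k L \<and> galois_extension E k L"
  then interpret finite_galois E k L
    using assms unfolding finite_galois_def finite_galois_axioms_def finite_extension_def by blast
  show "boolean_extension E k L \<longleftrightarrow> cyclic_extension E k L \<and> squarefree_degree E k L"
    by (rule boolean_extension_iff_cyclic)
qed

end
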